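(* Let $G=C_{n_1}\oplus C_{n_2}$ with $n_1\mid n_2$, and let $p$ be the smallest prime divisor of $|G|$. Assume $p\geq 3$, $n_1\geq 2p$ and $|G|\geq 72p^6$. Then $\mathsf c_0(G)=|G|/p+p-2$.
   Context: For a finite abelian group $G$ (written additively), a sequence over $G$ is a finite unordered list of elements of $G$ with repetition allowed (an element of the free abelian monoid on $G$); its length $|S|$ is the number of terms counted with multiplicity. For a subgroup $H\le G$, $S_H$ denotes the subsequence of $S$ consisting of all terms of $S$ lying in $H$. A sequence $S$ is regular if $|S_H|\leq |H|-1$ for every proper subgroup $H\subsetneq G$. $\sum(S)$ denotes the set of all sums of nonempty subsequences of $S$, and $S$ is an additive basis of $G$ if $\sum(S)=G$. $\mathsf c_0(G)$ is the smallest integer $t$ such that every regular sequence over $G$ of length at least $t$ is an additive basis of $G$. $C_m$ denotes the cyclic group of order $m$. *)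

theory Defs
  imports "HOL-Library.Multiset" "HOL-Algebra.Algebra"
begin

text \<open>
  The groups of HOL-Algebra are written multiplicatively, so the sum of the terms of a sequence
  appears below as a product in \<open>G\<close>. Sequences over \<open>G\<close> are finite multisets.
\<close>

definition seq_over :: "('a, 'b) monoid_scheme \<Rightarrow> 'a multiset \<Rightarrow> bool" where
  "seq_over G S \<longleftrightarrow> set_mset S \<subseteq> carrier G"

text \<open>
  HOL-Algebra has no product over a multiset with values in a carrier-based group; the finite
  product over the distinct terms, each raised to its multiplicity, is the combined value of all
  terms counted with multiplicity.
\<close>

definition seq_sum :: "('a, 'b) monoid_scheme \<Rightarrow> 'a multiset \<Rightarrow> 'a" where
  "seq_sum G S = finprod G (\<lambda>x. x [^]\<^bsub>G\<^esub> count S x) (set_mset S)"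

definition subseq_sums :: "('a, 'b) monoid_scheme \<Rightarrow> 'a multiset \<Rightarrow> 'a set" where
  "subseq_sums G S = {seq_sum G T | T. T \<subseteq># S \<and> T \<noteq> {#}}"

definition additive_basis :: "('a, 'b) monoid_scheme \<Rightarrow> 'a multiset \<Rightarrow> bool" where
  "additive_basis G S \<longleftrightarrow> subseq_sums G S = carrier G"

definition regular_seq :: "('a, 'b) monoid_scheme \<Rightarrow> 'a multiset \<Rightarrow> bool" where
  "regular_seq G S \<longleftrightarrow> seq_over G S \<and>
     (\<forall>H. subgroup H G \<and> H \<noteq> carrier G \<longrightarrow> size {#x \<in># S. x \<in> H#} \<le> card H - 1)"

text \<open>
  Taking the minimum over the natural numbers loses nothing: for finite \<open>G\<close> the empty sequence is
  regular but is not an additive basis, so every admissible \<open>t\<close> is at least \<open>1\<close>.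
\<close>

definition c0 :: "('a, 'b) monoid_scheme \<Rightarrow> nat" where
  "c0 G = (LEAST t. \<forall>S. regular_seq G S \<and> t \<le> size S \<longrightarrow> additive_basis G S)"

end

theory Submission
  imports Defs "HOL-Library.Set_Algebras" "HOL-Library.Product_Plus"
begin

text \<open>
  Write \<open>N\<close> for the order of \<open>G\<close>. For the lower bound take the nonzero elements of a subgroup of index
  \<open>p\<close> together with \<open>p - 2\<close> copies of an element outside it: one coset contains no sum.

  For the upper bound let \<open>S\<close> be regular with \<open>N / p + p - 2\<close> terms. If the set of its subsequence sums
  has a nontrivial stabilizer, counting cosets shows that it is all of \<open>G\<close>. If the stabilizer is
  trivial, Kneser's theorem makes the number of sums superadditive over disjoint blocks of \<open>S\<close>, and
  as there are at most \<open>N\<close> sums, blocks with more than \<open>2 p + 1\<close> sums per term cover less than half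
  of \<open>S\<close>. The remaining terms contain no such block, hence take fewer than \<open>6 p\<^sup>3\<close> values, and those of
  high multiplicity generate a subgroup \<open>H\<close> in which each of them has small index. By the bound
  \<open>N / (2 p + 1)\<close> on the orders of elements they do not all lie in one cyclic group, and so terms from
  different cyclic groups can be combined into blocks with about \<open>p\<close> sums per term (\<open>2 p + 1\<close> if
  \<open>H = G\<close>). Altogether they have more than \<open>card H\<close> sums in \<open>H\<close>, which is absurd.
\<close>

section \<open>Subgroups, stabilizers and Kneser's theorem\<close>

text \<open>A single term is only sure to add one sum (\<open>card_ssum_ge_size\<close>), so about N
  / p terms are far from contradicting the bound N; in the aperiodic case the task is to gain a
  factor per term. The number 2 p + 1 serves two purposes. Element orders divide n2 = N / n1, and n1
  >= 2 p improves to n1 >= 2 p + 1 because N is odd, so every cyclic subgroup has index at least 2 p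
  + 1. Discarding the rich blocks costs at most N / (2 p + 1) of the N / p terms and leaves (p + 1)
  N / (p (2 p + 1)). With 2 p + 1 sums per term in G, or p sums per term in a subgroup of order at
  most N / p, this is too much: (p + 1) / p > 1 and (p + 1) / (2 p + 1) > 1 / p. In the first
  comparison the slack is N / p sums, while the errors have order p^5; this is where the power p^6
  comes from.\<close>

definition subgrp :: "'a::ab_group_add set \<Rightarrow> bool" where
  "subgrp K \<longleftrightarrow> 0 \<in> K \<and> (\<forall>x\<in>K. \<forall>y\<in>K. x - y \<in> K)"

definition stab :: "'a::ab_group_add set \<Rightarrow> 'a set" where
  "stab C = {x. {x} + C = C}"

lemma subgrp_zero: "subgrp K \<Longrightarrow> 0 \<in> K"
  by (simp add: subgrp_def)

lemma subgrp_diff: "subgrp K \<Longrightarrow> x \<in> K \<Longrightarrow> y \<in> K \<Longrightarrow> x - y \<in> K"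
  by (simp add: subgrp_def)

lemma subgrp_minus: "subgrp K \<Longrightarrow> x \<in> K \<Longrightarrow> - x \<in> K"
  using subgrp_diff[of K 0 x] subgrp_zero by fastforce

lemma subgrp_plus: "subgrp K \<Longrightarrow> x \<in> K \<Longrightarrow> y \<in> K \<Longrightarrow> x + y \<in> K"
  using subgrp_diff[of K x "- y"] subgrp_minus[of K y] by simp

lemma mem_sumset: "z \<in> A + B \<longleftrightarrow> (\<exists>a\<in>A. \<exists>b\<in>B. z = a + b)"
  by (simp add: set_plus_def)

lemma mem_translate: "z \<in> {x} + C \<longleftrightarrow> z - x \<in> C" for z x :: "'a::ab_group_add"
  by (metis add_diff_cancel_left' diff_add_cancel add.commute insertI1 mem_sumset singletonD)

lemma mem_translate': "z \<in> C + {x} \<longleftrightarrow> z - x \<in> C" for z x :: "'a::ab_group_add"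
  by (metis add.commute mem_translate)

lemma singleton_sumset: "{x} + {y} = {x + y}"
  by (auto simp: mem_sumset)

lemma card_translate [simp]: "card ({x} + C) = card C" for x :: "'a::ab_group_add"
  using card_plus_sing[of C x] by (simp add: add.commute)

lemma finite_translate [simp]: "finite ({x} + C) \<longleftrightarrow> finite C" for x :: "'a::ab_group_add"
proof -
  have "{x} + C = (+) x ` C" by (auto simp: mem_sumset)
  then show ?thesis by (simp add: finite_image_iff)
qed

lemma finite_sumset: "finite A \<Longrightarrow> finite B \<Longrightarrow> finite (A + B)"
  by (rule finite_set_plus)

lemma sumset_eq_empty [simp]: "A + B = {} \<longleftrightarrow> A = {} \<or> B = {}" for A B :: "'a::plus set"
  by (auto simp: set_plus_def)

lemma sumset_mono: "A \<subseteq> A' \<Longrightarrow> B \<subseteq> B' \<Longrightarrow> A + B \<subseteq> A' + B'" for A B :: "'a::plus set"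
  by (rule set_plus_mono2)

lemma card_sumset_ge: "finite A \<Longrightarrow> finite B \<Longrightarrow> a \<in> A \<Longrightarrow> card B \<le> card (A + B)"
  for a :: "'a::ab_group_add"
  using card_mono[of "A + B" "{a} + B"] sumset_mono[of "{a}" A B B] by (simp add: finite_sumset)

lemma subgrp_sumset_self: "subgrp K \<Longrightarrow> K + K = K"
  using subgrp_plus[of K] set_zero_plus2[of K K] subgrp_zero[of K] by (auto simp: mem_sumset)

lemma subset_sumset: "subgrp K \<Longrightarrow> C \<subseteq> C + K"
  using set_zero_plus2[of K C] subgrp_zero[of K] by (simp add: add.commute)

lemma sumset_subgrp_idem: "subgrp K \<Longrightarrow> C + K + K = C + K"
  by (simp add: add.assoc subgrp_sumset_self)

lemma subgrp_Int: "subgrp K \<Longrightarrow> subgrp L \<Longrightarrow> subgrp (K \<inter> L)"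
  by (simp add: subgrp_def)

lemma subgrp_sumset: assumes K: "subgrp K" and L: "subgrp L" shows "subgrp (K + L)"
  unfolding subgrp_def
proof safe
  show "0 \<in> K + L" using set_plus_intro[OF subgrp_zero[OF K] subgrp_zero[OF L]] by simp
next
  fix x y assume "x \<in> K + L" "y \<in> K + L"
  then obtain a b c d where "a \<in> K" "c \<in> K" "b \<in> L" "d \<in> L" "x = a + b" "y = c + d"
    by (auto simp: mem_sumset)
  then show "x - y \<in> K + L"
    using set_plus_intro[OF subgrp_diff[OF K, of a c] subgrp_diff[OF L, of b d]]
    by (simp add: algebra_simps)
qed

lemma stabI:
  assumes "finite C" "{x} + C \<subseteq> C" shows "x \<in> stab C"
  using card_subset_eq[OF assms] by (simp add: stab_def)

lemma stab_translate: "x \<in> stab C \<Longrightarrow> c \<in> C \<Longrightarrow> x + c \<in> C"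
  using set_plus_intro[of x "{x}" c C] by (simp add: stab_def)

lemma subgrp_stab: "subgrp (stab C)"
  unfolding subgrp_def
proof safe
  show "0 \<in> stab C" by (simp add: stab_def)
next
  fix x y assume x: "x \<in> stab C" and y: "y \<in> stab C"
  then have "{x} + C = {y} + C" by (simp add: stab_def)
  moreover have "{x - y} + C = {- y} + ({x} + C)" "{- y} + ({y} + C) = C"
    by (simp_all add: add.assoc[symmetric] singleton_sumset)
  ultimately show "x - y \<in> stab C" by (simp add: stab_def)
qed

lemma stab_sumset_self: "C + stab C = C"
proof
  show "C + stab C \<subseteq> C" using stab_translate[of _ C] by (fastforce simp: mem_sumset add.commute)
qed (rule subset_sumset[OF subgrp_stab])

lemma subset_stab: assumes "finite C" "C + K \<subseteq> C" shows "K \<subseteq> stab C"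
proof
  fix x assume "x \<in> K"
  then have "{x} + C \<subseteq> C" using assms(2) sumset_mono[of "{x}" K C C] by (auto simp: add.commute)
  then show "x \<in> stab C" using assms(1) by (rule stabI[rotated])
qed

lemma stab_mono_sumset: "stab C \<subseteq> stab (C + D)"
  by (auto simp: stab_def add.assoc[symmetric])

lemma stab_translate_eq: "stab ({x} + C) = stab C"
proof
  have "stab ({x} + C) \<subseteq> stab ({x} + C + {- x})" by (rule stab_mono_sumset)
  also have "{x} + C + {- x} = C" by (simp add: add.commute[of _ "{- x}"] add.assoc[symmetric] singleton_sumset)
  finally show "stab ({x} + C) \<subseteq> stab C" .
qed (use stab_mono_sumset[of C "{x}"] in \<open>simp add: add.commute\<close>)

lemma stab_subset_subgrp:
  assumes "subgrp K" "D \<noteq> {}" "D \<subseteq> {c} + K" shows "stab D \<subseteq> K"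
proof
  fix x assume x: "x \<in> stab D"
  obtain d where d: "d \<in> D" using assms by blast
  have "d - c \<in> K" "x + d - c \<in> K"
    using d stab_translate[OF x d] assms(3) mem_translate by blast+
  then have "(x + d - c) - (d - c) \<in> K" by (rule subgrp_diff[OF assms(1), rotated])
  then show "x \<in> K" by simp
qed

lemma finite_stab: assumes "finite C" "C \<noteq> {}" shows "finite (stab C)"
proof -
  obtain c where c: "c \<in> C" using assms by blast
  have "{c} + stab C \<subseteq> C" using c sumset_mono[of "{c}" C "stab C" "stab C"] by (simp add: stab_sumset_self)
  then show ?thesis using finite_subset[of "{c} + stab C" C] assms by auto
qed

lemma coset_subset:
  assumes "subgrp K" "C + K = C" "x \<in> C" "x \<in> {c} + K" shows "{c} + K \<subseteq> C"
proof
  fix y assume "y \<in> {c} + K"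
  then have "(y - c) - (x - c) \<in> K" using assms(1,4) subgrp_diff by (metis mem_translate)
  then have "x + (y - x) \<in> C + K" using assms(3) by (intro set_plus_intro) auto
  then show "y \<in> C" by (simp add: assms)
qed

section \<open>Kneser's theorem\<close>

definition kneser_bound :: "'a::ab_group_add set \<Rightarrow> 'a set \<Rightarrow> bool" where
  "kneser_bound A B \<longleftrightarrow>
     card (A + stab (A + B)) + card (B + stab (A + B)) \<le> card (A + B) + card (stab (A + B))"

lemma card_le_sum3:
  assumes "finite A" "finite B" "finite C" "D \<subseteq> A \<union> B \<union> C"
  shows "card D \<le> card A + card B + card C"
proof -
  have "card D \<le> card (A \<union> B \<union> C)" using assms by (intro card_mono) auto
  also have "\<dots> \<le> card (A \<union> B) + card C" by (rule card_Un_le)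
  also have "\<dots> \<le> card A + card B + card C" using card_Un_le[of A B] by simp
  finally show ?thesis .
qed

text \<open>
  DeVos's proof: a pair \<open>(C, K)\<close> with \<open>C \<subseteq> A + B\<close> stable under \<open>K\<close> and
  \<open>card C + card K \<ge> card (A \<inter> B) + card (A \<union> B + K)\<close> is called convergent; one with smallest \<open>K\<close>
  is shown to have \<open>K = H\<close>, since otherwise \<open>C\<close> can be enlarged inside a single \<open>K\<close>-coset.
\<close>

lemma kneser_core:
  fixes A B :: "'a::ab_group_add set"
  assumes fin: "finite A" "finite B" and H: "H = stab (A + B)"
    and AH: "A + H = A" and BH: "B + H = B" and ne: "A \<inter> B \<noteq> {}"
    and IH: "\<And>A' B' :: 'a set. finite A' \<Longrightarrow> finite B' \<Longrightarrow> A' \<noteq> {} \<Longrightarrow> B' \<noteq> {} \<Longrightarrow>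
               card (A' + B') < card (A + B) \<Longrightarrow> kneser_bound A' B'"
    and IH0: "kneser_bound (A \<inter> B) (A \<union> B)"
  shows "card A + card B \<le> card (A + B) + card H"
proof -
  define conv where "conv C K \<longleftrightarrow> subgrp K \<and> H \<subseteq> K \<and> C \<noteq> {} \<and> C \<subseteq> A + B \<and> C + K = C \<and>
      card (A \<inter> B) + card (A \<union> B + K) \<le> card C + card K" for C K
  have finS: "finite (A + B)" using fin by (rule finite_sumset)
  have sH: "subgrp H" unfolding H by (rule subgrp_stab)
  have ABH: "(A \<union> B) + H = A \<union> B" using AH BH by (simp add: Un_set_plus)
  \<comment> \<open>\<open>IH0\<close> makes the sumset of intersection and union, with its
    stabilizer, a first convergent pair.\<close>
  have conv0: "\<exists>K. conv ((A \<inter> B) + (A \<union> B)) K"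
  proof -
    let ?C = "(A \<inter> B) + (A \<union> B)" let ?K = "stab ?C"
    have sub: "?C \<subseteq> A + B"
    proof -
      have "(A \<inter> B) + A \<subseteq> A + B" using sumset_mono[of "A \<inter> B" B A A] by (simp add: add.commute)
      moreover have "(A \<inter> B) + B \<subseteq> A + B" by (rule sumset_mono) auto
      ultimately show ?thesis by (simp add: set_plus_Un)
    qed
    have finC: "finite ?C" using sub finS finite_subset by blast
    have "?C + H \<subseteq> ?C" using ABH by (simp add: add.assoc)
    then have HK: "H \<subseteq> ?K" by (rule subset_stab[OF finC])
    have "card (A \<inter> B) \<le> card ((A \<inter> B) + ?K)"
      using fin ne finC by (intro card_mono subset_sumset subgrp_stab finite_sumset finite_stab) auto
    then have "card (A \<inter> B) + card (A \<union> B + ?K) \<le> card ?C + card ?K"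
      using IH0 by (simp add: kneser_bound_def)
    moreover have "?C \<noteq> {}" using ne by auto
    ultimately have "conv ?C ?K"
      unfolding conv_def using HK sub subgrp_stab stab_sumset_self by blast
    then show ?thesis by blast
  qed
  define P where "P k \<longleftrightarrow> (\<exists>C K. conv C K \<and> card K = k)" for k
  have "\<exists>k. P k" unfolding P_def using conv0 by blast
  then have "P (LEAST k. P k)" by (rule LeastI_ex)
  then obtain C K where conv: "conv C K" and cK: "card K = (LEAST k. P k)" unfolding P_def by blast
  have least: "card K \<le> card K'" if "conv C' K'" for C' K'
    unfolding cK by (rule Least_le) (use that in \<open>auto simp: P_def\<close>)
  have K: "subgrp K" "H \<subseteq> K" and C: "C \<noteq> {}" "C \<subseteq> A + B" "C + K = C"
    and convle: "card (A \<inter> B) + card (A \<union> B + K) \<le> card C + card K"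
    using conv by (auto simp: conv_def)
  have finC: "finite C" using C(2) finS finite_subset by blast
  have finK: "finite K"
    using subset_stab[of C K] C finC finite_stab[of C] finite_subset by blast
  show ?thesis
  proof (cases "K = H")
    case True
    have "card C \<le> card (A + B)" using C(2) finS by (rule card_mono[rotated])
    then show ?thesis using convle True ABH card_Un_Int[OF fin] by simp
  next
    case False
    \<comment> \<open>Some coset \<open>Kc\<close> of \<open>K\<close> meets \<open>A + B\<close>
      without lying in it. As \<open>C\<close> is a union of \<open>K\<close>-cosets inside
      \<open>A + B\<close>, it is disjoint from \<open>Kc\<close>, which is where it will be
      enlarged.\<close>
    have "\<not> (A + B) + K \<subseteq> A + B"
      using subset_stab[OF finS, of K] False K(2) H by blast
    then obtain z where "z \<in> A + B + K" and z: "z \<notin> A + B" by blast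
    then obtain s k where s: "s \<in> A + B" "k \<in> K" "z = s + k" by (auto simp: mem_sumset[of _ _ K])
    then obtain a b where ab: "a \<in> A" "b \<in> B" "k \<in> K" "a + b + k \<notin> A + B"
      using z by (metis set_plus_elim)
    define Ka Kb Kc where "Ka = {a} + K" and "Kb = {b} + K" and "Kc = {a + b} + K"
    have finKs: "finite Ka" "finite Kb" "finite Kc" using finK by (auto simp: Ka_def Kb_def Kc_def)
    have cardKs: "card Ka = card K" "card Kb = card K" "card Kc = card K"
      by (auto simp: Ka_def Kb_def Kc_def)
    have Kcnot: "\<not> Kc \<subseteq> A + B" using ab by (auto simp: Kc_def mem_sumset)
    have CKc: "C \<inter> Kc = {}"
      using coset_subset[OF K(1) C(3)] Kcnot C(2) unfolding Kc_def by blast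
    define M where "M L = (A \<union> B + K) - (A \<union> B + L)" for L
    \<comment> \<open>By minimality of \<open>card K\<close> the pair
      \<open>(C \<union> D, L)\<close> is not convergent. Comparing this with the convergence of
      \<open>(C, K)\<close> cancels \<open>C\<close> and \<open>A \<inter> B\<close>.\<close>
    have nonconv: "card (M L) + card D + card L + 1 \<le> card K"
      if D: "D \<subseteq> A + B" "D \<subseteq> Kc" and L: "subgrp L" "H \<subseteq> L" "L \<subset> K" "D + L = D" for D L
    proof -
      have finL: "finite L" using L(3) finK finite_subset by blast
      have "\<not> card K \<le> card L" using L(3) finK psubset_card_mono by (meson not_le)
      then have "\<not> conv (C \<union> D) L" using least by blast
      moreover have "C + L = C"
        using sumset_mono[of C C L K] L(3) C(3) subset_sumset[OF L(1), of C] by blast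
      then have "(C \<union> D) + L = C \<union> D" using L(4) by (simp add: Un_set_plus)
      ultimately have "card (C \<union> D) + card L < card (A \<inter> B) + card (A \<union> B + L)"
        unfolding conv_def using D(1) L(1,2) C(1,2) by auto
      moreover have "card (C \<union> D) = card C + card D"
        using CKc D(2) finC finKs(3) finite_subset by (intro card_Un_disjoint) blast+
      moreover have "card (M L) = card (A \<union> B + K) - card (A \<union> B + L)"
        unfolding M_def using fin finL L(3) by (intro card_Diff_subset finite_sumset sumset_mono) auto
      moreover have "card (A \<union> B + L) \<le> card (A \<union> B + K)"
        using fin finK L(3) by (intro card_mono finite_sumset sumset_mono) auto
      ultimately show ?thesis using convle by linarith
    qed
    \<comment> \<open>\<open>A' + B'\<close> is smaller than \<open>A + B\<close> because it misses
      \<open>C\<close>, so Kneser's inequality bounds \<open>card D\<close> from below in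
      \<open>nonconv\<close>; with \<open>L\<close> its stabilizer, \<open>card L\<close>
      cancels.\<close>
    have local: "\<exists>L. subgrp L \<and> H \<subseteq> L \<and> L \<subset> K \<and> A' + B' + L = A' + B' \<and>
        card (M L) + card (A' + L) + card (B' + L) + 1 \<le> card K"
      if *: "A' \<subseteq> A" "B' \<subseteq> B" "A' \<noteq> {}" "B' \<noteq> {}" "A' + H = A'" "A' + B' \<subseteq> Kc" for A' B'
    proof -
      let ?D = "A' + B'" let ?L = "stab ?D"
      have sub: "?D \<subseteq> A + B" using * by (intro sumset_mono)
      have finD: "finite ?D" using sub finS finite_subset by blast
      have "?D + H = (A' + H) + B'" by (simp only: ac_simps)
      then have HL: "H \<subseteq> ?L" using * by (intro subset_stab[OF finD]) simp
      have LK: "?L \<subseteq> K"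
        by (rule stab_subset_subgrp[OF K(1), of _ "a + b"]) (use * in \<open>auto simp: Kc_def\<close>)
      have "?L \<noteq> K"
      proof
        assume "?L = K"
        then have "?D + K = ?D" using stab_sumset_self[of ?D] by simp
        moreover obtain d where "d \<in> ?D" using * sumset_eq_empty[of A' B'] by blast
        ultimately have "Kc \<subseteq> ?D" using coset_subset[OF K(1), of ?D d "a + b"] *(6) unfolding Kc_def by blast
        then show False using Kcnot sub by blast
      qed
      then have LK: "?L \<subset> K" using LK by blast
      have "card ?D < card (A + B)"
      proof (rule psubset_card_mono[OF finS])
        show "?D \<subset> A + B" using sub C(1,2) CKc *(6) by blast
      qed
      then have "kneser_bound A' B'"
        by (intro IH) (use * fin in \<open>auto intro: finite_subset\<close>)
      then have "card (A' + ?L) + card (B' + ?L) \<le> card ?D + card ?L" by (simp add: kneser_bound_def)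
      with nonconv[OF sub *(6) subgrp_stab HL LK stab_sumset_self]
      have "card (M ?L) + card (A' + ?L) + card (B' + ?L) + 1 \<le> card K" by linarith
      then show ?thesis using HL LK subgrp_stab stab_sumset_self by blast
    qed
    define A1 A2 B1 B2 where "A1 = A \<inter> Ka" and "A2 = A \<inter> Kb" and "B1 = B \<inter> Kb" and "B2 = B \<inter> Ka"
    have fins: "finite A1" "finite A2" "finite B1" "finite B2"
      using fin by (auto simp: A1_def A2_def B1_def B2_def)
    have KaH: "Ka + H \<subseteq> Ka" "Kb + H \<subseteq> Kb"
      using sumset_mono[of Ka Ka H K] sumset_mono[of Kb Kb H K] K
      by (auto simp: Ka_def Kb_def add.assoc subgrp_sumset_self)
    have A1H: "A1 + H = A1" "A2 + H = A2"
    proof -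
      have "A1 + H \<subseteq> A + H" "A1 + H \<subseteq> Ka + H" "A2 + H \<subseteq> A + H" "A2 + H \<subseteq> Kb + H"
        by (simp_all add: A1_def A2_def sumset_mono)
      then show "A1 + H = A1" "A2 + H = A2"
        using AH KaH subset_sumset[OF sH, of A1] subset_sumset[OF sH, of A2] unfolding A1_def A2_def by blast+
    qed
    have A1: "a \<in> A1" and B1: "b \<in> B1"
      using ab subset_sumset[OF K(1)] by (auto simp: A1_def B1_def Ka_def Kb_def)
    have "Ka + Kb = {a + b} + (K + K)" by (simp add: Ka_def Kb_def ac_simps flip: singleton_sumset)
    then have KaKb: "Ka + Kb = Kc" by (simp add: Kc_def subgrp_sumset_self K)
    have D1: "A1 + B1 \<subseteq> Kc" unfolding KaKb[symmetric] by (intro sumset_mono) (auto simp: A1_def B1_def)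
    have D2: "A2 + B2 \<subseteq> Kc" unfolding KaKb[symmetric] add.commute[of Ka] by (intro sumset_mono) (auto simp: A2_def B2_def)
    obtain K1 where K1: "subgrp K1" "H \<subseteq> K1" "K1 \<subset> K" "A1 + B1 + K1 = A1 + B1"
      and c1: "card (M K1) + card (A1 + K1) + card (B1 + K1) + 1 \<le> card K"
    proof -
      have "A1 \<subseteq> A" "B1 \<subseteq> B" "A1 \<noteq> {}" "B1 \<noteq> {}" using A1 B1 by (auto simp: A1_def B1_def)
      from local[OF this A1H(1) D1] show ?thesis using that by blast
    qed
    have subM: "Ka - ((A1 \<union> B2) + L) \<subseteq> M L" "Kb - ((A2 \<union> B1) + L) \<subseteq> M L" if L: "L \<subseteq> K" for L
    proof -
      have Kx: "Ka \<subseteq> A \<union> B + K" "Kb \<subseteq> A \<union> B + K"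
        using ab by (simp_all add: Ka_def Kb_def sumset_mono)
      have "y \<in> {c} + K" if "y + l \<in> {c} + K" "l \<in> L" for y l c
      proof -
        have "y + l - c - l \<in> K" by (rule subgrp_diff[OF K(1)]) (use that L in \<open>auto simp: mem_translate\<close>)
        then show ?thesis by (simp add: mem_translate)
      qed
      then have "({c} + K) \<inter> (A \<union> B + L) \<subseteq> ((A \<union> B) \<inter> ({c} + K)) + L" for c
        by (fastforce simp: mem_sumset[of _ _ L])
      note this[of a] this[of b]
      moreover have "(A \<union> B) \<inter> ({a} + K) = A1 \<union> B2" "(A \<union> B) \<inter> ({b} + K) = A2 \<union> B1"
        by (auto simp: A1_def A2_def B1_def B2_def Ka_def Kb_def)
      ultimately show "Ka - ((A1 \<union> B2) + L) \<subseteq> M L" "Kb - ((A2 \<union> B1) + L) \<subseteq> M L"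
        using Kx unfolding M_def Ka_def Kb_def by (simp_all only:) blast+
    qed
    have finM: "finite (M L)" for L unfolding M_def using fin finK by (auto intro!: finite_sumset)
    have finL: "finite L" if "L \<subseteq> K" for L using that finK finite_subset by blast
    have coverA: "card K \<le> card (Ka - ((A1 \<union> B2) + L)) + card (A1 + L) + card (B2 + L)" if "L \<subseteq> K" for L
      unfolding cardKs(1)[symmetric] using finKs fins finL[OF that]
      by (intro card_le_sum3) (auto simp: Un_set_plus intro!: finite_sumset)
    have coverB: "card K \<le> card (Kb - ((A2 \<union> B1) + L)) + card (A2 + L) + card (B1 + L)" if "L \<subseteq> K" for L
      unfolding cardKs(2)[symmetric] using finKs fins finL[OF that]
      by (intro card_le_sum3) (auto simp: Un_set_plus intro!: finite_sumset)
    have leA: "card (Ka - ((A1 \<union> B2) + L)) \<le> card (M L)" if "L \<subseteq> K" for L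
      using finM subM(1)[OF that] by (rule card_mono)
    have leB: "card (Kb - ((A2 \<union> B1) + L)) \<le> card (M L)" if "L \<subseteq> K" for L
      using finM subM(2)[OF that] by (rule card_mono)
    have K1K: "K1 \<subseteq> K" using K1 by blast
    \<comment> \<open>If \<open>Ka = Kb\<close>, or if \<open>A2\<close> or \<open>B2\<close> were
      empty, then \<open>M K1\<close> and the pieces \<open>A1\<close>, \<open>B1\<close> would be
      large enough to fill a coset of \<open>K\<close>, against \<open>c1\<close>.\<close>
    have neq: "Ka \<noteq> Kb"
    proof
      assume "Ka = Kb"
      then have "B2 = B1" by (simp add: B1_def B2_def)
      then show False using coverA[OF K1K] leA[OF K1K] c1 by simp
    qed
    have A2: "A2 \<noteq> {}"
    proof
      assume "A2 = {}"
      then show False using coverB[OF K1K] leB[OF K1K] c1 by simp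
    qed
    have B2: "B2 \<noteq> {}"
    proof
      assume "B2 = {}"
      then show False using coverA[OF K1K] leA[OF K1K] c1 by simp
    qed
    obtain K2 where K2: "subgrp K2" "H \<subseteq> K2" "K2 \<subset> K" "A2 + B2 + K2 = A2 + B2"
      and c2: "card (M K2) + card (A2 + K2) + card (B2 + K2) + 1 \<le> card K"
    proof -
      have "A2 \<subseteq> A" "B2 \<subseteq> B" by (auto simp: A2_def B2_def)
      from local[OF this A2 B2 A1H(2) D2] show ?thesis using that by blast
    qed
    have K2K: "K2 \<subseteq> K" using K2 by blast
    have "Ka \<inter> Kb = {}"
    proof (rule ccontr)
      assume "Ka \<inter> Kb \<noteq> {}"
      then obtain x where x: "x \<in> Ka" "x \<in> Kb" by blast
      have "Ka + K = Ka" "Kb + K = Kb" by (simp_all add: Ka_def Kb_def sumset_subgrp_idem K)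
      then have "Kb \<subseteq> Ka" "Ka \<subseteq> Kb"
        using coset_subset[OF K(1)] x unfolding Ka_def Kb_def by metis+
      then show False using neq by blast
    qed
    then have disj: "(Ka - Y) \<inter> (Kb - Z) = {}" for Y Z by blast
    have leAB: "card (Ka - ((A1 \<union> B2) + L)) + card (Kb - ((A2 \<union> B1) + L)) \<le> card (M L)"
      if "L \<subseteq> K" for L
      using card_mono[OF finM, of "(Ka - ((A1 \<union> B2) + L)) \<union> (Kb - ((A2 \<union> B1) + L))" L]
        subM[OF that] finKs card_Un_disjoint[OF _ _ disj, of "A1 \<union> B2 + L" "A2 \<union> B1 + L"] by simp
    have big1: "card K < card (A2 + K1) + card (B2 + K1)"
      using leAB[OF K1K] coverA[OF K1K] coverB[OF K1K] c1 by linarith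
    have big2: "card K < card (A1 + K2) + card (B1 + K2)"
      using leAB[OF K2K] coverA[OF K2K] coverB[OF K2K] c2 by linarith
    define Q where "Q = K1 + K2"
    have Q: "subgrp Q" unfolding Q_def using K1 K2 by (intro subgrp_sumset)
    have QK: "Q \<subseteq> K" unfolding Q_def using sumset_mono[OF K1K K2K] K by (simp add: subgrp_sumset_self)
    have K12Q: "K1 \<subseteq> Q" "K2 \<subseteq> Q" unfolding Q_def using subset_sumset[of K2 K1] subset_sumset[of K1 K2] K1 K2
      by (auto simp: add.commute)
    have meet: "\<exists>y\<in>Y. \<exists>z\<in>Z. z - y \<in> Q"
      if Y: "Y \<subseteq> {c} + K" and Z: "Z \<subseteq> {c} + K" and big: "card K < card (Y + Q) + card (Z + Q)" for Y Z c
    proof -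
      have "Y + Q \<subseteq> {c} + K + K" "Z + Q \<subseteq> {c} + K + K" using Y Z QK by (intro sumset_mono; blast)+
      then have sub: "(Y + Q) \<union> (Z + Q) \<subseteq> {c} + K" by (simp add: sumset_subgrp_idem K)
      have "(Y + Q) \<inter> (Z + Q) \<noteq> {}"
      proof
        assume "(Y + Q) \<inter> (Z + Q) = {}"
        moreover have "finite (Y + Q)" "finite (Z + Q)" using sub finK by (auto intro: finite_subset[of _ "{c} + K"])
        ultimately have "card (Y + Q) + card (Z + Q) = card ((Y + Q) \<union> (Z + Q))" by (simp add: card_Un_disjoint)
        also have "\<dots> \<le> card ({c} + K)" using sub finK by (intro card_mono) auto
        finally show False using big by simp
      qed
      then obtain y q z q' where "y \<in> Y" "q \<in> Q" "z \<in> Z" "q' \<in> Q" "y + q = z + q'"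
        by (fastforce simp: mem_sumset)
      moreover from this have "z - y = q - q'" by (simp add: algebra_simps)
      ultimately show ?thesis using subgrp_diff[OF Q] by metis
    qed
    have mono: "card (Y + L) \<le> card (Y + Q)" if "L \<subseteq> Q" "finite Y" for Y L
      using that finL[OF QK] by (intro card_mono finite_sumset sumset_mono) auto
    \<comment> \<open>Add \<open>big1\<close> and \<open>big2\<close> and regroup by coset:
      \<open>B1\<close>, \<open>A2\<close> in \<open>Kb\<close> or \<open>B2\<close>,
      \<open>A1\<close> in \<open>Ka\<close> are together too large modulo \<open>Q\<close> to be
      disjoint there.\<close>
    have cases: "(\<exists>b1\<in>B1. \<exists>a2\<in>A2. a2 - b1 \<in> Q) \<or> (\<exists>b2\<in>B2. \<exists>a1\<in>A1. a1 - b2 \<in> Q)"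
    proof -
      have "card K < card (B1 + Q) + card (A2 + Q) \<or> card K < card (B2 + Q) + card (A1 + Q)"
        using big1 big2 mono[OF K12Q(1) fins(2)] mono[OF K12Q(1) fins(4)]
          mono[OF K12Q(2) fins(1)] mono[OF K12Q(2) fins(3)] by linarith
      then show ?thesis
        using meet[of B1 b A2] meet[of B2 a A1] unfolding A1_def A2_def B1_def B2_def Ka_def Kb_def by blast
    qed
    define D L where "D = (A1 + B1) \<union> (A2 + B2)" and "L = K1 \<inter> K2"
    have L: "subgrp L" "H \<subseteq> L" "L \<subset> K" using K1 K2 subgrp_Int[OF K1(1) K2(1)] unfolding L_def by blast+
    have LK: "L \<subseteq> K" using L by blast
    have "D + L = D"
    proof -
      have "A1 + B1 + L \<subseteq> A1 + B1 + K1" "A2 + B2 + L \<subseteq> A2 + B2 + K2" by (simp_all add: L_def sumset_mono)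
      then show ?thesis unfolding D_def using K1(4) K2(4) subset_sumset[OF L(1)] by (simp add: Un_set_plus) blast
    qed
    moreover have "D \<subseteq> Kc" using D1 D2 by (simp add: D_def)
    moreover have "D \<subseteq> A + B" unfolding D_def A1_def A2_def B1_def B2_def by (simp add: sumset_mono)
    ultimately have small: "card (M L) + card D + card L + 1 \<le> card K" using L by (intro nonconv)
    \<comment> \<open>In the first case translation by \<open>c = b1 + k1 = a2 - k2\<close> carries
      \<open>Kc - D\<close> into the part of \<open>Ka\<close> that is missed: a point landing in
      \<open>A1 + L\<close> would come from \<open>A1 + B1 + K1\<close>, one landing in
      \<open>B2 + L\<close> from \<open>A2 + B2 + K2\<close>, and both sets lie in \<open>D\<close>.
      The second case is symmetric. The resulting bound contradicts \<open>small\<close>.\<close>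
    have "card (Kc - D) \<le> card (M L)"
      using cases
    proof (elim disjE bexE)
      fix b1 a2 assume *: "b1 \<in> B1" "a2 \<in> A2" "a2 - b1 \<in> Q"
      then obtain k1 k2 where k: "k1 \<in> K1" "k2 \<in> K2" "a2 - b1 = k1 + k2" by (auto simp: Q_def mem_sumset)
      define c where "c = b1 + k1"
      have c: "c = a2 - k2" using k(3) by (simp add: c_def algebra_simps)
      have cK: "c - b \<in> K" using * k K1K subgrp_plus[OF K(1), of "b1 - b" k1]
        by (auto simp: c_def B1_def Kb_def mem_translate mem_translate' algebra_simps)
      have "(\<lambda>e. e - c) ` (Kc - D) \<subseteq> Ka - ((A1 \<union> B2) + L)"
      proof (intro image_subsetI DiffI)
        fix e assume e: "e \<in> Kc - D"
        then show "e - c \<in> Ka" using subgrp_diff[OF K(1) _ cK, of "e - (a + b)"]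
          by (auto simp: Ka_def Kc_def mem_translate mem_translate' algebra_simps)
        show "e - c \<notin> (A1 \<union> B2) + L"
        proof
          assume "e - c \<in> (A1 \<union> B2) + L"
          then obtain x l where x: "x \<in> A1 \<or> x \<in> B2" and l: "l \<in> K1" "l \<in> K2" and e': "e - c = x + l"
            by (auto simp: mem_sumset L_def)
          from x show False
          proof
            assume "x \<in> A1"
            then have "x + b1 + (k1 + l) \<in> A1 + B1 + K1" using * k l K1 by (intro set_plus_intro subgrp_plus)
            then show False using e e' K1(4) by (simp add: c_def D_def algebra_simps)
          next
            assume "x \<in> B2"
            then have "a2 + x + (l - k2) \<in> A2 + B2 + K2" using * k l K2 by (intro set_plus_intro subgrp_diff)
            moreover have "a2 + x + (l - k2) = e"
              using e' unfolding c diff_eq_eq by (simp add: algebra_simps)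
            ultimately show False using e K2(4) by (simp add: D_def)
          qed
        qed
      qed
      then have "card (Kc - D) \<le> card (Ka - ((A1 \<union> B2) + L))"
        using finKs by (intro card_inj_on_le[of "\<lambda>e. e - c"]) (auto simp: inj_on_def)
      then show ?thesis using leA[OF LK] by linarith
    next
      fix b2 a1 assume *: "b2 \<in> B2" "a1 \<in> A1" "a1 - b2 \<in> Q"
      then obtain k1 k2 where k: "k1 \<in> K1" "k2 \<in> K2" "a1 - b2 = k1 + k2" by (auto simp: Q_def mem_sumset)
      define c where "c = b2 + k2"
      have c: "c = a1 - k1" using k(3) by (simp add: c_def algebra_simps)
      have cK: "c - a \<in> K" using * k K2K subgrp_plus[OF K(1), of "b2 - a" k2]
        by (auto simp: c_def B2_def Ka_def mem_translate mem_translate' algebra_simps)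
      have "(\<lambda>e. e - c) ` (Kc - D) \<subseteq> Kb - ((A2 \<union> B1) + L)"
      proof (intro image_subsetI DiffI)
        fix e assume e: "e \<in> Kc - D"
        then show "e - c \<in> Kb" using subgrp_diff[OF K(1) _ cK, of "e - (a + b)"]
          by (auto simp: Kb_def Kc_def mem_translate mem_translate' algebra_simps)
        show "e - c \<notin> (A2 \<union> B1) + L"
        proof
          assume "e - c \<in> (A2 \<union> B1) + L"
          then obtain x l where x: "x \<in> A2 \<or> x \<in> B1" and l: "l \<in> K1" "l \<in> K2" and e': "e - c = x + l"
            by (auto simp: mem_sumset L_def)
          from x show False
          proof
            assume "x \<in> A2"
            then have "x + b2 + (k2 + l) \<in> A2 + B2 + K2" using * k l K2 by (intro set_plus_intro subgrp_plus)
            then show False using e e' K2(4) by (simp add: c_def D_def algebra_simps)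
          next
            assume "x \<in> B1"
            then have "a1 + x + (l - k1) \<in> A1 + B1 + K1" using * k l K1 by (intro set_plus_intro subgrp_diff)
            moreover have "a1 + x + (l - k1) = e"
              using e' unfolding c diff_eq_eq by (simp add: algebra_simps)
            ultimately show False using e K1(4) by (simp add: D_def)
          qed
        qed
      qed
      then have "card (Kc - D) \<le> card (Kb - ((A2 \<union> B1) + L))"
        using finKs by (intro card_inj_on_le[of "\<lambda>e. e - c"]) (auto simp: inj_on_def)
      then show ?thesis using leB[OF LK] by linarith
    qed
    moreover have "card (Kc - D) = card K - card D"
      using \<open>D \<subseteq> Kc\<close> finKs cardKs by (subst card_Diff_subset) (auto intro: finite_subset)
    ultimately show ?thesis using small by linarith
  qed
qed

text \<open>Outer induction on \<open>card (A + B)\<close>, inner induction on the size of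
  \<open>A\<close> saturated by the stabilizer. A translate of \<open>B\<close> meets
  \<open>A0\<close> without containing it; passing to intersection and union then either shrinks the
  sumset, or keeps it and shrinks the first set.\<close>

theorem kneser:
  fixes A B :: "'a::ab_group_add set"
  assumes "finite A" "finite B" "A \<noteq> {}" "B \<noteq> {}"
  shows "kneser_bound A B"
  using assms
proof (induction "card (A + B)" arbitrary: A B rule: less_induct)
  case less
  from less.hyps less.prems show ?case
  proof (induction "card (A + stab (A + B))" arbitrary: A B rule: less_induct)
    case less
    note IH = less.prems(1)
    define H where "H = stab (A + B)"
    define A0 B0 where "A0 = A + H" and "B0 = B + H"
    have sH: "subgrp H" unfolding H_def by (rule subgrp_stab)
    have fin: "finite (A + B)" "A + B \<noteq> {}" using less.prems(2-) by (auto intro: finite_sumset)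
    then have finH: "finite H" unfolding H_def by (rule finite_stab)
    have fin0: "finite A0" "finite B0" "A0 \<noteq> {}" "B0 \<noteq> {}"
      using less.prems(2-) finH subgrp_zero[OF sH] by (auto simp: A0_def B0_def intro: finite_sumset)
    have sH': "A0 + H = A0" "B0 + H = B0" by (simp_all add: A0_def B0_def sumset_subgrp_idem sH)
    have "A0 + B0 = A + B + H + H" by (simp only: A0_def B0_def ac_simps)
    then have sum0: "A0 + B0 = A + B" by (simp add: H_def stab_sumset_self)
    have "card A0 + card B0 \<le> card (A + B) + card H"
    proof (cases "\<exists>a. A0 \<subseteq> {a} + H")
      case True
      then obtain a where "A0 \<subseteq> {a} + H" by blast
      then have "card A0 \<le> card H" using card_mono[of "{a} + H" A0] finH by simp
      moreover have "card B0 \<le> card (A0 + B0)" using fin0 card_sumset_ge by blast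
      ultimately show ?thesis using sum0 by simp
    next
      case False
      obtain a where a: "a \<in> A0" using fin0 by blast
      obtain a' where a': "a' \<in> A0" "a' \<notin> {a} + H" using False by blast
      have "stab B0 \<subseteq> H" unfolding H_def sum0[symmetric] add.commute[of A0] by (rule stab_mono_sumset)
      then have "a' - a \<notin> stab B0" using a'(2) by (auto simp: mem_translate)
      then have "\<not> {a' - a} + B0 \<subseteq> B0" using stabI fin0 by blast
      then obtain z where "z \<in> {a' - a} + B0" "z \<notin> B0" by blast
      then obtain b where b: "b \<in> B0" "a' - a + b \<notin> B0" by (auto simp: mem_sumset)
      define B1 where "B1 = {a - b} + B0"
      have B1: "finite B1" "B1 + H = B1" "card B1 = card B0"
        using fin0 sH' by (simp_all add: B1_def add.assoc)
      have sum1: "A0 + B1 = {a - b} + (A + B)" unfolding B1_def sum0[symmetric] by (simp only: ac_simps)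
      have stab1: "stab (A0 + B1) = H" unfolding sum1 H_def by (rule stab_translate_eq)
      have card1: "card (A0 + B1) = card (A + B)" unfolding sum1 by simp
      have mem: "a \<in> A0 \<inter> B1" "a' \<notin> B1" using a b by (simp_all add: B1_def mem_translate diff_diff_eq2 add_diff_eq diff_add_eq)
      have "kneser_bound (A0 \<inter> B1) (A0 \<union> B1)"
      proof -
        let ?C = "(A0 \<inter> B1) + (A0 \<union> B1)"
        have "(A0 \<inter> B1) + A0 \<subseteq> A0 + B1" using sumset_mono[of "A0 \<inter> B1" B1 A0 A0] by (simp add: add.commute)
        moreover have "(A0 \<inter> B1) + B1 \<subseteq> A0 + B1" by (rule sumset_mono) auto
        ultimately have sub: "?C \<subseteq> A0 + B1" by (simp add: set_plus_Un)
        have fin1: "finite (A0 + B1)" using fin0 B1 by (intro finite_sumset)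
        show ?thesis
        proof (cases "?C = A0 + B1")
          case True
          have "A0 \<inter> B1 + H \<subseteq> A0 \<inter> B1"
            using sH' B1 sumset_mono[of "A0 \<inter> B1" A0 H H] sumset_mono[of "A0 \<inter> B1" B1 H H] by auto
          then have "card (A0 \<inter> B1 + stab ?C) \<le> card (A0 \<inter> B1)"
            unfolding True stab1 using fin0 by (intro card_mono) auto
          also have "\<dots> < card A0" using mem a' fin0 by (intro psubset_card_mono) auto
          finally have "card (A0 \<inter> B1 + stab ?C) < card (A + stab (A + B))" by (simp add: A0_def H_def)
          then show ?thesis
          proof (rule less.hyps)
            show "finite (A0 \<inter> B1)" "finite (A0 \<union> B1)" "A0 \<inter> B1 \<noteq> {}" "A0 \<union> B1 \<noteq> {}"
              using fin0 B1(1) mem by auto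
            show "kneser_bound A' B'" if "card (A' + B') < card ?C" "finite A'" "finite B'" "A' \<noteq> {}" "B' \<noteq> {}"
              for A' B' :: "'a set"
              using that unfolding True card1 by (rule IH)
          qed
        next
          case False
          then have "card ?C < card (A + B)" using sub fin1 card1 psubset_card_mono by (metis psubsetI)
          then show ?thesis using fin0 B1 mem by (intro IH) auto
        qed
      qed
      then have "card A0 + card B1 \<le> card (A0 + B1) + card H"
      proof (rule kneser_core[OF fin0(1) B1(1) stab1[symmetric] sH'(1) B1(2), rotated 2])
        show "A0 \<inter> B1 \<noteq> {}" using mem by blast
        show "kneser_bound A' B'" if "finite A'" "finite B'" "A' \<noteq> {}" "B' \<noteq> {}" "card (A' + B') < card (A0 + B1)"
          for A' B' :: "'a set"
          using that(5,1-4) unfolding card1 by (rule IH)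
      qed
      then show ?thesis using B1 card1 by simp
    qed
    then show ?case by (simp add: kneser_bound_def A0_def B0_def H_def)
  qed
qed

section \<open>Subsequence sums\<close>

text \<open>Counting the empty subsequence turns multiset union into sumset, but hides whether 0 is
  the sum of a nonempty subsequence; \<open>zero_sum\<close> settles that.\<close>

definition ssum :: "'a::comm_monoid_add multiset \<Rightarrow> 'a set" where
  "ssum S = {sum_mset T | T. T \<subseteq># S}"

lemma zero_in_ssum: "0 \<in> ssum S"
  unfolding ssum_def by (rule CollectI, rule exI[of _ "{#}"]) simp

lemma ssum_nonempty [simp]: "ssum S \<noteq> {}"
  using zero_in_ssum[of S] by blast

lemma ssum_union: "ssum (A + B) = ssum A + ssum B"
proof
  show "ssum (A + B) \<subseteq> ssum A + ssum B"
  proof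
    fix z assume "z \<in> ssum (A + B)"
    then obtain T where T: "T \<subseteq># A + B" "z = sum_mset T" by (auto simp: ssum_def)
    have "T = (T \<inter># A) + (T - A)" by (rule multiset_eqI) simp
    then have "z = sum_mset (T \<inter># A) + sum_mset (T - A)" using T(2) by (metis sum_mset.union)
    moreover have "T - A \<subseteq># B" using T(1) by (simp add: subset_eq_diff_conv add.commute)
    moreover have "T \<inter># A \<subseteq># A" by simp
    ultimately show "z \<in> ssum A + ssum B" unfolding mem_sumset ssum_def by blast
  qed
  show "ssum A + ssum B \<subseteq> ssum (A + B)"
  proof
    fix z assume "z \<in> ssum A + ssum B"
    then obtain T U where "T \<subseteq># A" "U \<subseteq># B" "z = sum_mset (T + U)"
      by (auto simp: ssum_def mem_sumset)
    then show "z \<in> ssum (A + B)" unfolding ssum_def using subset_mset.add_mono by blast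
  qed
qed

lemma ssum_empty [simp]: "ssum {#} = {0}"
  by (auto simp: ssum_def)

lemma ssum_single [simp]: "ssum {#x#} = {0, x}"
proof
  show "ssum {#x#} \<subseteq> {0, x}"
  proof
    fix z assume "z \<in> ssum {#x#}"
    then obtain T where T: "T \<subseteq># {#x#}" "z = sum_mset T" by (auto simp: ssum_def)
    then have "T = {#} \<or> T = {#x#}" by (metis nonempty_subseteq_mset_eq_single)
    then show "z \<in> {0, x}" using T by auto
  qed
  have "sum_mset {#x#} \<in> ssum {#x#}" unfolding ssum_def by blast
  then show "{0, x} \<subseteq> ssum {#x#}" using zero_in_ssum[of "{#x#}"] by simp
qed

lemma ssum_add_mset: "ssum (add_mset x S) = ssum S \<union> ({x} + ssum S)"
  using ssum_union[of "{#x#}" S] by (simp add: insert_set_plus Un_commute)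

lemma finite_ssum [simp]: "finite (ssum S)" for S :: "'a::ab_group_add multiset"
  by (induction S) (auto simp: ssum_add_mset)

lemma ssum_subset: "subgrp K \<Longrightarrow> set_mset S \<subseteq> K \<Longrightarrow> ssum S \<subseteq> K"
proof (induction S)
  case (add x S)
  then have "ssum S \<subseteq> K" "x \<in> K" by simp_all
  then have "{x} + ssum S \<subseteq> K + K" by (intro sumset_mono) auto
  then show ?case using \<open>ssum S \<subseteq> K\<close> by (simp add: ssum_add_mset subgrp_sumset_self[OF add.prems(1)])
qed (simp add: subgrp_zero)

lemma stab_ssum_mono: assumes "A \<subseteq># B" shows "stab (ssum A) \<subseteq> stab (ssum B)"
proof -
  have "ssum B = ssum A + ssum (B - A)" using assms by (metis ssum_union subset_mset.add_diff_inverse)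
  then show ?thesis using stab_mono_sumset by metis
qed

text \<open>What stabilizes the sums of a subsequence also stabilizes \<open>ssum S\<close>, so
  Kneser's inequality applies with trivial stabilizer.\<close>

lemma card_ssum_superadditive:
  fixes S :: "'a::ab_group_add multiset"
  assumes "stab (ssum S) = {0}" "A + B \<subseteq># S"
  shows "card (ssum A) + card (ssum B) \<le> card (ssum (A + B)) + 1"
proof -
  have "stab (ssum (A + B)) \<subseteq> {0}" using stab_ssum_mono[OF assms(2)] assms(1) by simp
  then have "stab (ssum A + ssum B) = {0}" using subgrp_zero[OF subgrp_stab] by (auto simp: ssum_union)
  then show ?thesis using kneser[of "ssum A" "ssum B"] by (simp add: kneser_bound_def ssum_union)
qed

lemma card_ssum_ge_size:
  fixes S :: "'a::ab_group_add multiset"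
  assumes "stab (ssum S) = {0}" "0 \<notin># S" "T \<subseteq># S"
  shows "size T + 1 \<le> card (ssum T)"
  using assms(3)
proof (induction T)
  case (add x T)
  then have T: "T \<subseteq># S" by (meson mset_subset_eq_insertD subset_mset.less_imp_le)
  have "x \<noteq> 0" using add.prems assms(2) by (metis mset_subset_eqD union_single_eq_member)
  then have "card (ssum {#x#}) = 2" by simp
  then show ?case
    using card_ssum_superadditive[OF assms(1), of "{#x#}" T] add.prems add.IH[OF T] by simp
qed simp

lemma card_ssum_sum:
  fixes S :: "'a::ab_group_add multiset"
  assumes "stab (ssum S) = {0}" "finite I" "(\<Sum>i\<in>I. B i) \<subseteq># S"
  shows "(\<Sum>i\<in>I. card (ssum (B i))) + 1 \<le> card (ssum (\<Sum>i\<in>I. B i)) + card I"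
  using assms(2,3)
proof (induction I)
  case (insert i I)
  then have "B i + sum B I \<subseteq># S" by simp
  then have "sum B I \<subseteq># S" using mset_subset_eq_add_right subset_mset.order_trans by blast
  then show ?case
    using insert card_ssum_superadditive[OF assms(1), of "B i" "\<Sum>i\<in>I. B i"] by simp
qed simp

text \<open>Each term \<open>x\<close> outside \<open>K\<close> adds at least one whole
  \<open>K\<close>-coset: otherwise translation by \<open>x\<close> would preserve
  \<open>ssum T + K\<close>, hence \<open>ssum S\<close>, and \<open>x\<close> would lie in
  \<open>K\<close>.\<close>

lemma card_ssum_stab:
  fixes S :: "'a::ab_group_add multiset"
  assumes K: "K = stab (ssum S)" and "T \<subseteq># S"
  shows "card K * (1 + size {#s \<in># T. s \<notin> K#}) \<le> card (ssum T + K)"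
  using assms(2)
proof (induction T)
  case (add x T)
  have sK: "subgrp K" unfolding K by (rule subgrp_stab)
  have finK: "finite K" unfolding K by (rule finite_stab) auto
  have T: "T \<subseteq># S" using add.prems by (meson mset_subset_eq_insertD subset_mset.less_imp_le)
  let ?B = "ssum T + K"
  have eq: "ssum (add_mset x T) + K = ?B \<union> ({x} + ?B)"
    by (simp add: ssum_add_mset Un_set_plus add.assoc)
  have finB: "finite ?B" using finK by (intro finite_sumset) auto
  show ?case
  proof (cases "x \<in> K")
    case True
    then show ?thesis using add.IH[OF T] card_mono[of "?B \<union> ({x} + ?B)" ?B] finB unfolding eq by simp
  next
    case False
    have "\<not> {x} + ?B \<subseteq> ?B"
    proof
      assume "{x} + ?B \<subseteq> ?B"
      then have "x \<in> stab ?B" using finB by (intro stabI)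
      also have "\<dots> \<subseteq> stab (?B + ssum (S - T))" by (rule stab_mono_sumset)
      also have "?B + ssum (S - T) = ssum (T + (S - T)) + K" unfolding ssum_union by (simp only: ac_simps)
      also have "\<dots> = ssum S" using T by (simp add: K stab_sumset_self)
      finally show False using False K by simp
    qed
    then obtain z where z: "z \<in> {x} + ?B" "z \<notin> ?B" by blast
    have "{z} + K \<subseteq> {x} + ?B"
      using sumset_mono[of "{z}" "{x} + ?B" K K] z(1) by (simp add: sumset_subgrp_idem[OF sK] add.assoc[symmetric])
    moreover have "({z} + K) \<inter> ?B = {}"
    proof (rule ccontr)
      assume "({z} + K) \<inter> ?B \<noteq> {}"
      then have "{z} + K \<subseteq> ?B" using coset_subset[OF sK, of ?B] by (auto simp: sumset_subgrp_idem[OF sK])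
      then show False using z(2) subset_sumset[OF sK, of "{z}"] by auto
    qed
    ultimately have "card ?B + card ({z} + K) \<le> card (?B \<union> ({x} + ?B))"
      using finB finK by (subst card_Un_disjoint[symmetric]) (auto intro!: card_mono)
    then show ?thesis using add.IH[OF T] False unfolding eq by simp
  qed
qed simp

text \<open>The 2 in place of 1 accounts for the \<open>K\<close>-coset of an element of
  \<open>V\<close> that is not a sum: all of that coset is missed.\<close>

lemma card_stab_le:
  fixes S :: "'a::ab_group_add multiset"
  assumes V: "subgrp V" "finite V" and S: "set_mset S \<subseteq> V" and K: "K = stab (ssum S)"
    and ne: "ssum S \<noteq> V"
  shows "K \<subseteq> V" "K \<noteq> V" "card K * (2 + size {#s \<in># S. s \<notin> K#}) \<le> card V"
proof -
  have sK: "subgrp K" unfolding K by (rule subgrp_stab)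
  have SK: "ssum S + K = ssum S" unfolding K by (rule stab_sumset_self)
  have sub: "ssum S \<subseteq> V" using ssum_subset[OF V(1) S] .
  show KV: "K \<subseteq> V"
  proof
    fix x assume "x \<in> K"
    then have "x + 0 \<in> ssum S" unfolding K by (rule stab_translate[OF _ zero_in_ssum])
    then show "x \<in> V" using sub by auto
  qed
  show "K \<noteq> V"
    using ne sub SK sumset_mono[of "{0}" "ssum S" K K] zero_in_ssum[of S] by auto
  obtain z where z: "z \<in> V" "z \<notin> ssum S" using ne sub by blast
  have "{z} + K \<subseteq> V"
    using z KV sumset_mono[of "{z}" V K V] by (simp add: subgrp_sumset_self[OF V(1)])
  moreover have "({z} + K) \<inter> ssum S = {}"
  proof (rule ccontr)
    assume "({z} + K) \<inter> ssum S \<noteq> {}"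
    then have "{z} + K \<subseteq> ssum S" using coset_subset[OF sK SK] by auto
    then show False using z(2) subset_sumset[OF sK, of "{z}"] by auto
  qed
  ultimately have "card (ssum S) + card ({z} + K) \<le> card V"
    using sub V(2) KV finite_subset[OF KV]
    by (subst card_Un_disjoint[symmetric]) (auto intro!: card_mono)
  then show "card K * (2 + size {#s \<in># S. s \<notin> K#}) \<le> card V"
    using card_ssum_stab[OF K subset_mset.order_refl] by (simp add: SK)
qed

section \<open>Multiples, cyclic subgroups and cosets\<close>

primrec nmul :: "nat \<Rightarrow> 'a::comm_monoid_add \<Rightarrow> 'a" where
  "nmul 0 x = 0"
| "nmul (Suc n) x = x + nmul n x"

lemma nmul_add: "nmul (m + n) x = nmul m x + nmul n x"
  by (induction m) (simp_all add: ac_simps)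

lemma nmul_zero [simp]: "nmul n 0 = 0"
  by (induction n) simp_all

lemma nmul_mult: "nmul (m * n) x = nmul m (nmul n x)"
  by (induction m) (simp_all add: nmul_add)

lemma nmul_plus: "nmul n (x + y) = nmul n x + nmul n y"
  by (induction n) (simp_all add: ac_simps)

lemma nmul_mem: "subgrp K \<Longrightarrow> x \<in> K \<Longrightarrow> nmul n x \<in> K"
  by (induction n) (simp_all add: subgrp_zero subgrp_plus)

lemma nmul_diff: "i \<le> j \<Longrightarrow> nmul (j - i) x = nmul j x - nmul i x" for x :: "'a::ab_group_add"
  using nmul_add[of "j - i" i x] by simp

lemma nmul_in_ssum: "i \<le> n \<Longrightarrow> nmul i x \<in> ssum (replicate_mset n x)"
proof -
  assume "i \<le> n"
  then have "replicate_mset i x \<subseteq># replicate_mset n x" by (simp add: subseteq_mset_def)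
  moreover have "sum_mset (replicate_mset i x) = nmul i x" by (induction i) simp_all
  ultimately show ?thesis unfolding ssum_def by (intro CollectI exI[of _ "replicate_mset i x"]) simp
qed

text \<open>Translation by \<open>x\<close> permutes \<open>V\<close> and so fixes the sum of all
  its elements.\<close>

lemma nmul_card: assumes "subgrp V" "finite V" "x \<in> V" shows "nmul (card V) x = 0"
proof -
  have "(\<Sum>y\<in>V. x + y) = (\<Sum>y\<in>V. y)"
    using assms subgrp_plus[OF assms(1)] subgrp_diff[OF assms(1)]
    by (intro sum.reindex_bij_witness[of _ "\<lambda>y. y - x" "\<lambda>y. x + y"]) auto
  then have "(\<Sum>y\<in>V. x) = 0" by (simp add: sum.distrib)
  moreover have "(\<Sum>y\<in>A. x) = nmul (card A) x" if "finite A" for A :: "'a set"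
    using that by (induction A) simp_all
  ultimately show ?thesis using assms(2) by simp
qed

definition cyc :: "'a::ab_group_add \<Rightarrow> 'a set" where
  "cyc x = range (\<lambda>n. nmul n x)"

lemma mem_cyc: "x \<in> cyc x"
  unfolding cyc_def by (rule range_eqI[of _ _ 1]) simp

lemma cyc_subset: "subgrp K \<Longrightarrow> x \<in> K \<Longrightarrow> cyc x \<subseteq> K"
  by (auto simp: cyc_def nmul_mem)

text \<open>\<open>cyc\<close> collects nonnegative multiples, but in a finite group these include
  negatives: if \<open>card V = Suc m\<close>, then \<open>m\<close> times \<open>z\<close> is
  \<open>- z\<close>.\<close>

lemma subgrp_cyc: assumes V: "subgrp V" "finite V" and x: "x \<in> V" shows "subgrp (cyc x)"
  unfolding subgrp_def
proof safe
  show "0 \<in> cyc x" unfolding cyc_def by (rule range_eqI[of _ _ 0]) simp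
next
  fix y z assume "y \<in> cyc x" "z \<in> cyc x"
  then obtain i j where ij: "y = nmul i x" "z = nmul j x" by (auto simp: cyc_def)
  have "card V > 0" using V x by (auto simp: card_gt_0_iff)
  then obtain m where m: "card V = Suc m" using gr0_implies_Suc by blast
  have "nmul (j * m) x + z = nmul (j * card V) x" unfolding m by (simp add: ij nmul_add)
  also have "\<dots> = 0" using nmul_card[OF V x] by (simp add: nmul_mult)
  finally have "y - z = nmul (i + j * m) x" by (simp add: ij nmul_add eq_neg_iff_add_eq_0 algebra_simps)
  then show "y - z \<in> cyc x" unfolding cyc_def by blast
qed

lemma card_cyc_le: assumes "nmul n x = 0" "n > 0" shows "card (cyc x) \<le> n"
proof -
  have "nmul k x \<in> (\<lambda>i. nmul i x) ` {..<n}" for k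
  proof -
    have "nmul k x = nmul (k div n * n + k mod n) x" by simp
    also have "\<dots> = nmul (k mod n) x" using assms by (simp only: nmul_add nmul_mult) simp
    finally show ?thesis using assms by auto
  qed
  then have "cyc x \<subseteq> (\<lambda>i. nmul i x) ` {..<n}" by (auto simp: cyc_def)
  then have "card (cyc x) \<le> card ((\<lambda>i. nmul i x) ` {..<n})" by (intro card_mono) auto
  also have "\<dots> \<le> n" using card_image_le[of "{..<n}"] by simp
  finally show ?thesis .
qed

lemma card_cosets:
  fixes A :: "'a::ab_group_add set"
  assumes K: "subgrp K" "A \<subseteq> K" "finite A" and x: "\<And>i. 0 < i \<Longrightarrow> i < n \<Longrightarrow> nmul i x \<notin> K"
  shows "card (\<Union>i<n. {nmul i x} + A) = n * card A"
proof -
  have disj: "({nmul i x} + A) \<inter> ({nmul j x} + A) = {}" if "i < j" "j < n" for i j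
  proof (rule ccontr)
    assume "({nmul i x} + A) \<inter> ({nmul j x} + A) \<noteq> {}"
    then obtain z where "z - nmul i x \<in> A" "z - nmul j x \<in> A" by (auto simp: mem_translate)
    then have "z - nmul i x \<in> K" "z - nmul j x \<in> K" using K(2) by blast+
    then have "(z - nmul i x) - (z - nmul j x) \<in> K" by (rule subgrp_diff[OF K(1)])
    then have "nmul (j - i) x \<in> K" using that by (simp add: nmul_diff)
    then show False using x[of "j - i"] that by simp
  qed
  have "card (\<Union>i<n. {nmul i x} + A) = (\<Sum>i<n. card ({nmul i x} + A))"
  proof (intro card_UN_disjoint ballI impI)
    fix i j assume "i \<in> {..<n}" "j \<in> {..<n}" "i \<noteq> j"
    then show "({nmul i x} + A) \<inter> ({nmul j x} + A) = {}"
      using disj[of i j] disj[of j i] by (cases "i < j") auto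
  qed (use K in auto)
  then show ?thesis by simp
qed

text \<open>The multiples \<open>nmul i x\<close> with \<open>i < n\<close> lie in distinct cosets
  of \<open>K\<close>, so \<open>n - 1\<close> copies of \<open>x\<close> multiply the number of
  sums by \<open>n\<close>. The factors \<open>p\<close> and \<open>2 * p + 1\<close> per term arise
  here.\<close>

lemma card_ssum_replicate:
  fixes T :: "'a::ab_group_add multiset"
  assumes K: "subgrp K" "set_mset T \<subseteq> K" and x: "\<And>i. 0 < i \<Longrightarrow> i < n \<Longrightarrow> nmul i x \<notin> K" and n: "n > 0"
  shows "n * card (ssum T) \<le> card (ssum (T + replicate_mset (n - 1) x))"
proof -
  have "n * card (ssum T) = card (\<Union>i<n. {nmul i x} + ssum T)"
    using card_cosets[OF K(1) ssum_subset[OF K] _ x] by simp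
  also have "\<dots> \<le> card (ssum (T + replicate_mset (n - 1) x))"
  proof (rule card_mono)
    show "(\<Union>i<n. {nmul i x} + ssum T) \<subseteq> ssum (T + replicate_mset (n - 1) x)"
    proof (rule UN_least)
      fix i assume "i \<in> {..<n}"
      then have "{nmul i x} \<subseteq> ssum (replicate_mset (n - 1) x)" using nmul_in_ssum[of i "n - 1" x] by auto
      then show "{nmul i x} + ssum T \<subseteq> ssum (T + replicate_mset (n - 1) x)"
        unfolding ssum_union add.commute[of "ssum T"] by (intro sumset_mono) auto
    qed
  qed simp
  finally show ?thesis .
qed

section \<open>Growth of the sums of distinct elements\<close>

text \<open>
  Averaging over \<open>a\<close>: a pair of distinct elements \<open>b\<close>, \<open>b - a\<close> of the sum set determines \<open>a\<close>.
\<close>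

lemma growth_step:
  fixes A T :: "'a::ab_group_add set"
  assumes A: "finite A" "0 \<notin> A" "T \<subseteq> A" and M: "0 < M" "M \<le> card (A - T)"
  defines "x \<equiv> card (ssum (mset_set T))"
  shows "\<exists>a\<in>A - T. 2 * M * x \<le> M * card (ssum (mset_set (insert a T))) + x * (x - 1)"
proof -
  let ?B = "ssum (mset_set T)"
  let ?I = "\<lambda>a. ?B \<inter> ({a} + ?B)"
  have "\<exists>a\<in>A - T. M * card (?I a) \<le> x * (x - 1)"
  proof (rule ccontr)
    assume *: "\<not> ?thesis"
    have "A - T \<noteq> {}" using M by (metis card.empty not_le)
    then have "(\<Sum>a\<in>A - T. x * (x - 1)) < (\<Sum>a\<in>A - T. M * card (?I a))"
      using A(1) * by (intro sum_strict_mono) (auto simp: not_le)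
    also have "\<dots> = M * card (SIGMA a:A - T. ?I a)"
      using A(1) by (subst card_SigmaI) (auto simp: sum_distrib_left)
    also have "card (SIGMA a:A - T. ?I a) \<le> card (?B \<times> ?B - Id_on ?B)"
    proof (rule card_inj_on_le[of "\<lambda>(a, b). (b, b - a)"])
      show "(\<lambda>(a, b). (b, b - a)) ` (SIGMA a:A - T. ?I a) \<subseteq> ?B \<times> ?B - Id_on ?B"
        using A(2) by (auto simp: mem_translate Id_on_def)
    qed (auto simp: inj_on_def)
    also have "\<dots> = x * (x - 1)"
    proof -
      have "Id_on ?B = (\<lambda>b. (b, b)) ` ?B" by (auto simp: Id_on_def)
      then have "card (Id_on ?B) = x" by (simp add: card_image inj_on_def x_def)
      then show ?thesis
        by (subst card_Diff_subset) (auto simp: Id_on_def card_cartesian_product x_def algebra_simps)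
    qed
    also have "M * (x * (x - 1)) \<le> (\<Sum>a\<in>A - T. x * (x - 1))" using M by simp
    finally show False by simp
  qed
  then obtain a where a: "a \<in> A - T" "M * card (?I a) \<le> x * (x - 1)" by blast
  have "finite T" using A finite_subset by blast
  then have "ssum (mset_set (insert a T)) = ?B \<union> ({a} + ?B)" using a by (simp add: ssum_add_mset)
  then have "card (ssum (mset_set (insert a T))) + card (?I a) = 2 * x"
    using card_Un_Int[of ?B "{a} + ?B"] by (simp add: x_def)
  then have "2 * M * x = M * card (ssum (mset_set (insert a T))) + M * card (?I a)"
    by (metis add_mult_distrib2 mult.assoc mult.commute)
  then show ?thesis using a by (intro bexI[of _ a]) linarith+
qed

text \<open>
  Adding elements one at a time, the sum set reaches the sizes 1, 2, 4, 8, 16, 31, 56 and then grows by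
  a factor of nearly 3/2 until it exceeds \<open>4 * p\<^sup>2 + 2 * p\<close>.
\<close>

lemma distinct_growth:
  fixes A :: "'a::ab_group_add set"
  assumes p: "3 \<le> p" and A: "finite A" "0 \<notin> A" "6 * p ^ 3 \<le> card A"
  shows "\<exists>T\<subseteq>A. T \<noteq> {} \<and> (2 * p + 1) * card T + 1 \<le> card (ssum (mset_set T))"
proof -
  \<comment> \<open>\<open>L = (2 * p + 1) * (2 * p)\<close>, so at most \<open>2 * p\<close>
    elements with more than \<open>L\<close> sums are wanted; while they are chosen, at least
    \<open>M\<close> elements of \<open>A\<close> remain available.\<close>
  define L where "L = 4 * p\<^sup>2 + 2 * p"
  define M where "M = 6 * p ^ 3 - 2 * p"
  define P where "P i y \<longleftrightarrow> (\<exists>T\<subseteq>A. card T \<le> i \<and>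
      (y \<le> card (ssum (mset_set T)) \<or> L < card (ssum (mset_set T))))" for i y
  have p3: "3 * (3 * p) \<le> 3 * p\<^sup>2" "3 * p\<^sup>2 \<le> p ^ 3"
    using p by (simp_all add: power2_eq_square power3_eq_cube)
  have M: "156 \<le> M" "2 * L \<le> M"
  proof -
    have "27 \<le> p ^ 3" using power_mono[OF p, of 3] by simp
    then show "156 \<le> M" using p3 unfolding M_def by linarith
    have "2 * L + 2 * p \<le> 6 * p ^ 3" using p3 p unfolding L_def by simp
    then show "2 * L \<le> M" unfolding M_def by linarith
  qed
  have step: "P (Suc i) z"
    if P: "P i y" and i: "i < 2 * p" and y: "y \<le> L" and z: "M * (z - 1) + y * (y - 1) < 2 * M * y" for i y z
  proof -
    obtain T where T: "T \<subseteq> A" "card T \<le> i"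
      and or: "y \<le> card (ssum (mset_set T)) \<or> L < card (ssum (mset_set T))"
      using P by (auto simp: P_def)
    define x where "x = card (ssum (mset_set T))"
    show ?thesis
    proof (cases "L < x")
      case True
      then show ?thesis using T unfolding P_def x_def by (intro exI[of _ T]) auto
    next
      case False
      then have yx: "y \<le> x" "x \<le> L" using or by (auto simp: x_def)
      have finT: "finite T" using T A finite_subset by blast
      have "M \<le> card (A - T)" using T i A finT by (simp add: card_Diff_subset M_def)
      then obtain a where a: "a \<in> A - T" "2 * M * x \<le> M * card (ssum (mset_set (insert a T))) + x * (x - 1)"
        using growth_step[OF A(1,2) T(1), of M] M(1) by (auto simp: x_def)
      \<comment> \<open>The guaranteed value \<open>2 * M * x - x * (x - 1)\<close> increases with
        \<open>x\<close> up to \<open>M\<close>, so the actual size \<open>x\<close> may be replaced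
        by its lower bound \<open>y\<close>.\<close>
      have "M * (z - 1) < M * card (ssum (mset_set (insert a T)))"
      proof -
        obtain d where d: "x = y + d" using yx le_Suc_ex by blast
        have "x + y \<le> 2 * M" using yx M y by linarith
        then have "d * (x + y) \<le> d * (2 * M)" by (rule mult_left_mono) simp
        moreover have "x * (x - 1) \<le> y * (y - 1) + d * (x + y)"
          unfolding d by (cases "y"; cases d) (simp_all add: algebra_simps)
        moreover have "2 * M * x = 2 * M * y + d * (2 * M)" unfolding d by (simp add: algebra_simps)
        ultimately show ?thesis using z a(2) by linarith
      qed
      then have "z - 1 < card (ssum (mset_set (insert a T)))" by simp
      then have "z \<le> card (ssum (mset_set (insert a T)))" by linarith
      then show ?thesis using a T finT unfolding P_def by (intro exI[of _ "insert a T"]) auto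
    qed
  qed
  have mono: "P i z" if "P i y" "z \<le> y" for i y z using that unfolding P_def by (meson order_trans)
  have half: "P (Suc i) (y + y div 2)" if P: "P i y" and i: "i < 2 * p" and y: "0 < y" "y \<le> L" for i y
  proof (rule step[OF P i y(2)])
    have "2 * (y + y div 2 - 1) \<le> 2 * (y - 1) + y" using y(1) by linarith
    then have "M * (2 * (y + y div 2 - 1)) \<le> M * (2 * (y - 1) + y)" by (rule mult_left_mono) simp
    then have "2 * (M * (y + y div 2 - 1)) \<le> 2 * (M * (y - 1)) + M * y"
      by (simp only: distrib_left mult.left_commute[of M 2])
    moreover have "2 * (y * (y - 1)) < M * y"
    proof -
      have "2 * (y - 1) < M" using y M by linarith
      then show ?thesis using y(1) by (simp add: mult.left_commute mult.commute[of M])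
    qed
    moreover have "M * (y - 1) + M = M * y" using y(1) by (cases y) simp_all
    ultimately show "M * (y + y div 2 - 1) + y * (y - 1) < 2 * M * y" by linarith
  qed
  have L: "42 \<le> L" using power_mono[OF p, of 2] p unfolding L_def by simp
  have P0: "P 0 1" unfolding P_def by (intro exI[of _ "{}"]) simp
  have "P (Suc 0) 2" by (rule step[OF P0]) (use M L p in auto)
  then have "P (Suc (Suc 0)) 4" by (rule step) (use M L p in auto)
  then have "P (Suc (Suc (Suc 0))) 8" by (rule step) (use M L p in auto)
  then have "P (Suc (Suc (Suc (Suc 0)))) 16" by (rule step) (use M L p in auto)
  then have "P (Suc (Suc (Suc (Suc (Suc 0))))) 31" by (rule step) (use M L p in auto)
  then have "P (Suc (Suc (Suc (Suc (Suc (Suc 0)))))) 56" by (rule step) (use M L p in auto)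
  then have P6: "P (2 * 3) (4 * 3\<^sup>2 + 2 * 3 + 1)" by (auto simp: numeral_eq_Suc intro: mono)
  \<comment> \<open>Two steps multiply the size by almost 9/4, more than the target grows from
    \<open>q\<close> to \<open>q + 1\<close> once \<open>q >= 3\<close>; at \<open>q = 3\<close> the
    target 43 is below 56.\<close>
  have "P (2 * q) (4 * q\<^sup>2 + 2 * q + 1)" if "3 \<le> q" "q \<le> p" for q
    using that
  proof (induction q rule: dec_induct)
    case base
    show ?case by (rule P6)
  next
    case (step q)
    define y where "y = 4 * q\<^sup>2 + 2 * q + 1"
    define z where "z = y + y div 2"
    have Py: "P (2 * q) y" using step unfolding y_def by simp
    have qq: "3 * q \<le> q\<^sup>2" using step by (simp add: power2_eq_square)
    have "(q + 1)\<^sup>2 \<le> p\<^sup>2" using step by (intro power_mono) auto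
    then have yL: "4 * (q\<^sup>2 + 2 * q + 1) + 2 * (q + 1) \<le> L"
      using step unfolding L_def by (simp add: power2_eq_square)
    then have "y \<le> L" unfolding y_def by simp
    then have Pz: "P (Suc (2 * q)) z" unfolding z_def using Py step by (intro half) (auto simp: y_def)
    have bound: "4 * (Suc q)\<^sup>2 + 2 * Suc q + 1 \<le> z + z div 2"
    proof -
      have "4 * (Suc q)\<^sup>2 + 2 * Suc q + 1 = 4 * q\<^sup>2 + 10 * q + 7" by (simp add: power2_eq_square)
      moreover have "4 * q\<^sup>2 + 10 * q + 7 \<le> z + z div 2"
      proof -
        have *: "3 * n \<le> 2 * (n + n div 2) + 1" for n :: nat by presburger
        have "9 * y \<le> 4 * (z + z div 2) + 5" using *[of y] *[of z] by (simp add: z_def)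
        moreover have "9 * y = 36 * q\<^sup>2 + 18 * q + 9" by (simp add: y_def)
        ultimately show ?thesis using qq step(1) by simp
      qed
      ultimately show ?thesis by simp
    qed
    show ?case
    proof (cases "z \<le> L")
      case True
      then have "P (Suc (Suc (2 * q))) (z + z div 2)" using Pz step by (intro half) (auto simp: z_def y_def)
      then show ?thesis using bound by (auto intro: mono)
    next
      case False
      then obtain T where "T \<subseteq> A" "card T \<le> Suc (2 * q)" "L < card (ssum (mset_set T))"
        using Pz unfolding P_def by (meson leI order_less_le_trans)
      then show ?thesis unfolding P_def by (intro exI[of _ T]) auto
    qed
  qed
  then have "P (2 * p) (L + 1)" using p by (simp add: L_def)
  then obtain T where T: "T \<subseteq> A" "card T \<le> 2 * p" "L < card (ssum (mset_set T))"
    by (auto simp: P_def)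
  have "(2 * p + 1) * card T \<le> (2 * p + 1) * (2 * p)" using T(2) by (rule mult_left_mono) simp
  also have "\<dots> = L" by (simp add: L_def power2_eq_square algebra_simps)
  finally have "(2 * p + 1) * card T + 1 \<le> card (ssum (mset_set T))" using T(3) by simp
  moreover have "T \<noteq> {}" using T(3) L by auto
  ultimately show ?thesis using T(1) by blast
qed

section \<open>Regular sequences over groups of small exponent\<close>

text \<open>The strict inequality avoids the truncated \<open>card H - 1\<close>; the two agree for
  finite \<open>V\<close>, where subgroups have positive cardinality.\<close>

definition regular_in :: "'a::ab_group_add set \<Rightarrow> 'a multiset \<Rightarrow> bool" where
  "regular_in V S \<longleftrightarrow> set_mset S \<subseteq> V \<and>
     (\<forall>K. subgrp K \<and> K \<subseteq> V \<and> K \<noteq> V \<longrightarrow> size {#x \<in># S. x \<in> K#} < card K)"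

lemma regular_in_subset: "regular_in V S \<Longrightarrow> T \<subseteq># S \<Longrightarrow> regular_in V T"
  unfolding regular_in_def
  using set_mset_mono[of T S] size_mset_mono[OF multiset_filter_mono, of T S] by (blast intro: le_less_trans)

text \<open>These record the error terms of the final count. The first stems from fewer than
  \<open>6 * p ^ 3\<close> values of multiplicity at most \<open>2 * p + 3\<close>, the next two
  from recombining classes in \<open>many_sums\<close> with \<open>Q = 2 * p + 1\<close> and
  \<open>Q = p\<close>.\<close>

lemma power_identity_1: "p * (2 * p + 1) * (s + (2 * p + 3) * (6 * p ^ 3)) = p * (2 * p + 1) * s + (24 * p ^ 6 + 48 * p ^ 5 + 18 * p ^ 4)" for p :: nat
  by (simp add: algebra_simps numeral_eq_Suc)

lemma power_identity_2: "p * (h + 6 * p ^ 3 * (2 * p)\<^sup>2) = p * h + 24 * p ^ 6" for p :: nat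
  by (simp add: algebra_simps numeral_eq_Suc)

lemma power_identity_3: "p * (2 * p + 1) * (h + 6 * p ^ 3 * p\<^sup>2) = (2 * p + 1) * (p * h) + (12 * p ^ 7 + 6 * p ^ 6)" for p :: nat
  by (simp add: algebra_simps numeral_eq_Suc)

lemma power_identity_4: "p * (p * (2 * p + 1) * s + (24 * p ^ 6 + 48 * p ^ 5 + 18 * p ^ 4)) =
      p * (p * (2 * p + 1) * s) + (24 * p ^ 7 + 48 * p ^ 6 + 18 * p ^ 5)" for p :: nat
  by (simp add: algebra_simps numeral_eq_Suc)

lemma power_identity_5: "p * (72 * p ^ 6) = 72 * p ^ 7" for p :: nat
  by (simp add: algebra_simps numeral_eq_Suc)

lemmas power_identities = power_identity_1 power_identity_2 power_identity_3 power_identity_4 power_identity_5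

lemma sum_filter_classes:
  assumes "finite C" "\<And>x. x \<in># M \<Longrightarrow> F x \<in> C"
  shows "(\<Sum>c\<in>C. {#x \<in># M. F x = c#}) = M"
  using assms(2)
proof (induction M)
  case (add x M)
  have "(\<Sum>c\<in>C. {#y \<in># add_mset x M. F y = c#}) =
      (\<Sum>c\<in>C. (if c = F x then {#x#} else {#}) + {#y \<in># M. F y = c#})"
    by (rule sum.cong) auto
  also have "\<dots> = (\<Sum>c\<in>C. if c = F x then {#x#} else {#}) + (\<Sum>c\<in>C. {#y \<in># M. F y = c#})"
    by (rule sum.distrib)
  also have "(\<Sum>c\<in>C. {#y \<in># M. F y = c#}) = M" by (rule add.IH) (rule add.prems, simp)
  also have "(\<Sum>c\<in>C. if c = F x then {#x#} else {#}) = {#x#}"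
    using add.prems[of x] by (subst sum.delta[OF assms(1)]) simp
  finally show ?case by simp
qed simp

text \<open>A cyclic shift along an enumeration of \<open>C\<close>.\<close>

lemma fixpoint_free_permutation:
  assumes "finite C" "2 \<le> card C"
  shows "\<exists>f. bij_betw f C C \<and> (\<forall>c\<in>C. f c \<noteq> c)"
proof -
  obtain e where e: "bij_betw e {0..<card C} C" using ex_bij_betw_nat_finite[OF assms(1)] by blast
  define n where "n = card C"
  define s where "s i = (if Suc i = n then 0 else Suc i)" for i
  have s: "bij_betw s {0..<n} {0..<n}"
    by (rule bij_betw_byWitness[where f' = "\<lambda>i. if i = 0 then n - 1 else i - 1"])
      (use assms(2) in \<open>auto simp: s_def n_def\<close>)
  define d where "d = the_inv_into {0..<n} e"
  have d: "bij_betw d C {0..<n}" unfolding d_def using e by (simp add: bij_betw_the_inv_into n_def)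
  define f where "f = e \<circ> (s \<circ> d)"
  have "bij_betw f C C" unfolding f_def using bij_betw_trans[OF bij_betw_trans[OF d s]] e by (simp add: n_def)
  moreover have "f c \<noteq> c" if c: "c \<in> C" for c
  proof
    assume "f c = c"
    then have eq: "e (s (d c)) = c" by (simp add: f_def)
    have "e (d c) = c" using c e by (simp add: d_def n_def f_the_inv_into_f_bij_betw)
    moreover have "d c \<in> {0..<n}" "s (d c) \<in> {0..<n}" using bij_betwE[OF d] bij_betwE[OF s] c by blast+
    moreover have "inj_on e {0..<n}" using e by (simp add: bij_betw_def n_def)
    ultimately have "s (d c) = d c" using eq
      by (intro inj_onD[of e "{0..<n}" "s (d c)" "d c"]) (simp_all only:)
    then have "(if Suc (d c) = card C then 0 else Suc (d c)) = d c" by (simp only: s_def n_def)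
    then show False using assms(2) by presburger
  qed
  ultimately show ?thesis by blast
qed

text \<open>The decomposition of the group into two cyclic factors enters the upper bound through
  \<open>card_cyc\<close>.\<close>

locale small_exponent_group =
  fixes V :: "'a::ab_group_add set" and p :: nat
  assumes V: "subgrp V" and finV: "finite V"
    and p3: "3 \<le> p" and p_dvd: "p dvd card V"
    and p_least: "\<And>q. Factorial_Ring.prime q \<Longrightarrow> q dvd card V \<Longrightarrow> p \<le> q"
    and card_cyc: "\<And>x. x \<in> V \<Longrightarrow> (2 * p + 1) * card (cyc x) \<le> card V"
    and big: "72 * p ^ 6 \<le> card V"
begin

lemma V_pos: "0 < card V"
  using finV subgrp_zero[OF V] by (auto simp: card_gt_0_iff)

text \<open>\<open>i\<close> is below the least prime divisor of \<open>card V\<close>, hence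
  coprime to \<open>card V\<close>, so \<open>x\<close> is a multiple of
  \<open>nmul i x\<close>.\<close>

lemma nmul_notin:
  assumes K: "subgrp K" and x: "x \<in> V" "x \<notin> K" and i: "0 < i" "i < p"
  shows "nmul i x \<notin> K"
proof
  assume nK: "nmul i x \<in> K"
  have gcd: "gcd i (card V) = 1"
  proof (rule ccontr)
    assume "gcd i (card V) \<noteq> 1"
    then obtain q where q: "Factorial_Ring.prime q" "q dvd gcd i (card V)" using prime_factor_nat by blast
    then have dvd: "q dvd i" "q dvd card V" using dvd_trans by blast+
    then have "q \<le> i" using i by (simp add: dvd_imp_le)
    then show False using p_least[OF q(1) dvd(2)] i by simp
  qed
  obtain a b where "i * a = card V * b + 1"
    using bezout_nat[OF gr_implies_not0[OF i(1)], of "card V"] unfolding gcd by blast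
  then have "nmul (a * i) x = nmul (b * card V + 1) x" by (simp add: mult.commute)
  also have "\<dots> = x" using nmul_card[OF V finV x(1)] by (simp only: nmul_add nmul_mult) simp
  finally show False using nmul_mem[OF K nK, of a] x(2) by (simp add: nmul_mult)
qed

lemma finite_subgrp: "K \<subseteq> V \<Longrightarrow> finite K"
  using finV finite_subset by blast

lemma card_proper:
  assumes K: "subgrp K" "K \<subseteq> V" "K \<noteq> V" shows "p * card K \<le> card V"
proof -
  obtain x where x: "x \<in> V" "x \<notin> K" using K by blast
  have "(\<Union>i<p. {nmul i x} + K) \<subseteq> V"
  proof (rule UN_least)
    fix i
    show "{nmul i x} + K \<subseteq> V"
      using sumset_mono[of "{nmul i x}" V K V] nmul_mem[OF V x(1)] K(2) by (simp add: subgrp_sumset_self[OF V])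
  qed
  then have "card (\<Union>i<p. {nmul i x} + K) \<le> card V" using finV by (rule card_mono[rotated])
  then show ?thesis
    using card_cosets[OF K(1) order_refl finite_subgrp[OF K(2)] nmul_notin[OF K(1) x]] by simp
qed

lemma card_nontrivial:
  assumes K: "subgrp K" "K \<subseteq> V" "K \<noteq> {0}" shows "p \<le> card K"
proof -
  obtain x where x: "x \<in> K" "x \<notin> {0}" using K subgrp_zero by blast
  have sub0: "subgrp {0::'a}" by (simp add: subgrp_def)
  have "(\<Union>i<p. {nmul i x} + {0}) \<subseteq> K" using nmul_mem[OF K(1) x(1)] by (auto simp: singleton_sumset)
  then have "card (\<Union>i<p. {nmul i x} + {0}) \<le> card K" using finite_subgrp[OF K(2)] by (rule card_mono[rotated])
  moreover have "card (\<Union>i<p. {nmul i x} + {0}) = p * card {0::'a}"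
    by (rule card_cosets[OF sub0]) (use nmul_notin[OF sub0, of x] x K in auto)
  ultimately show ?thesis by simp
qed

lemma cyc_proper: assumes "x \<in> V" shows "cyc x \<noteq> V"
  using card_cyc[OF assms] V_pos p3 by auto

lemma stab_size:
  assumes S: "regular_in V S" and K: "K = stab (ssum S)" "K \<noteq> {0}" and ne: "ssum S \<noteq> V"
  shows "subgrp K" "K \<subseteq> V" "K \<noteq> V"
    "card K * (2 + (size S - size {#s \<in># S. s \<in> K#})) \<le> card V"
    "size {#s \<in># S. s \<in> K#} < card K"
    "p \<le> card K" "p * card K \<le> card V"
proof -
  have SV: "set_mset S \<subseteq> V" using S by (simp add: regular_in_def)
  show sK: "subgrp K" unfolding K by (rule subgrp_stab)
  note * = card_stab_le[OF V finV SV K(1) ne]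
  show KV: "K \<subseteq> V" "K \<noteq> V" using *(1,2) by auto
  show "size {#s \<in># S. s \<in> K#} < card K" using S sK KV by (simp add: regular_in_def)
  show "p \<le> card K" using card_nontrivial[OF sK KV(1) K(2)] .
  show "p * card K \<le> card V" using card_proper[OF sK KV] .
  have "size S = size {#s \<in># S. s \<in> K#} + size {#s \<in># S. s \<notin> K#}"
    by (metis multiset_partition size_union)
  then show "card K * (2 + (size S - size {#s \<in># S. s \<in> K#})) \<le> card V" using *(3) by simp
qed

text \<open>
  The order \<open>k\<close> of the stabilizer lies between \<open>p\<close> and \<open>N / p\<close>, where \<open>k * (N / p + p - k) \<ge> N\<close>;
  this contradicts the count of \<open>stab_size\<close>.
\<close>

lemma periodic_imp_full:
  assumes S: "regular_in V S" and size: "card V div p + p - 2 \<le> size S" and "stab (ssum S) \<noteq> {0}"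
  shows "ssum S = V"
proof (rule ccontr)
  assume ne: "ssum S \<noteq> V"
  define K where "K = stab (ssum S)"
  have K0: "K \<noteq> {0}" using assms by (simp add: K_def)
  note K = stab_size[OF S K_def K0 ne]
  \<comment> \<open>With \<open>card K = p + u\<close> and \<open>N / p = card K + v\<close>, the
    count becomes \<open>u * v + p + u \<le> 0\<close>.\<close>
  obtain u where u: "card K = p + u" using K(6) le_Suc_ex by blast
  have N: "card V = p * (card V div p)" using p_dvd by simp
  then have "card K \<le> card V div p" using K(7) p3 by (metis mult_le_cancel1 not_numeral_le_zero zero_less_iff_neq_zero)
  then obtain v where v: "card V div p = card K + v" using le_Suc_ex by blast
  have "v + p + 1 \<le> 2 + (size S - size {#s \<in># S. s \<in> K#})" using size K(5) v p3 by linarith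
  then have "card K * (v + p + 1) \<le> card K * (2 + (size S - size {#s \<in># S. s \<in> K#}))" by (rule mult_le_mono2)
  also have "\<dots> \<le> p * (card K + v)" using K(4) N v by simp
  finally have "p * v + u * v + p + u \<le> p * v" unfolding u by (simp add: algebra_simps)
  then show False using p3 by simp
qed

end

text \<open>The assumptions are inconsistent, and the aim is \<open>False\<close>. Asking only for
  \<open>card V div p\<close> terms lets the result serve also for sequences with a term removed, as
  in \<open>almost_full\<close>.\<close>

locale aperiodic_seq = small_exponent_group V p for V :: "'a::ab_group_add set" and p +
  fixes S :: "'a multiset"
  assumes S: "regular_in V S" and S_size: "card V div p \<le> size S" and S_aper: "stab (ssum S) = {0}"
begin

lemma S_subset: "set_mset S \<subseteq> V"
  using S by (simp add: regular_in_def)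

lemma S_cyc: "x \<in> V \<Longrightarrow> size {#y \<in># S. y \<in> cyc x#} < card (cyc x)"
  using S cyc_proper[of x] cyc_subset[OF V, of x] subgrp_cyc[OF V finV, of x] by (simp add: regular_in_def)

lemma S_nonzero: "0 \<notin># S"
proof
  assume "0 \<in># S"
  moreover define Z where "Z = {#x \<in># S. x \<in> {0}#}"
  ultimately have "0 \<in># Z" by simp
  then have "Z \<noteq> {#}" by auto
  then have "0 < size Z" by (simp only: nonempty_has_size)
  moreover have sub0: "subgrp {0::'a}" by (simp add: subgrp_def)
  have "{0} \<noteq> V"
  proof
    assume "{0} = V"
    then have "card {0::'a} = card V" by (rule arg_cong)
    moreover have "0 < p ^ 6" using p3 by simp
    ultimately show False using big by simp
  qed
  then have "size Z < card {0::'a}"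
    using S sub0 subgrp_zero[OF V] unfolding regular_in_def Z_def by blast
  ultimately show False by simp
qed

lemma card_ssum_le: "set_mset T \<subseteq> V \<Longrightarrow> card (ssum T) \<le> card V"
  using card_mono[OF finV ssum_subset[OF V]] .

text \<open>
  \<open>R\<close> is the complement of a largest \<open>U\<close> with more than \<open>(2 * p + 1) * size U\<close> sums: the length of
  such a \<open>U\<close> is bounded, and by superadditivity no block of \<open>R\<close> has as many sums.
\<close>

lemma residual_exists:
  "\<exists>R. R \<subseteq># S \<and> (p + 1) * card V \<le> p * (2 * p + 1) * size R \<and>
     (\<forall>T. T \<subseteq># R \<longrightarrow> T \<noteq> {#} \<longrightarrow> card (ssum T) \<le> (2 * p + 1) * size T)"
proof -
  define rich where "rich T \<longleftrightarrow> (2 * p + 1) * size T + 1 \<le> card (ssum T)" for T :: "'a multiset"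
  define P where "P n \<longleftrightarrow> (\<exists>U. U \<subseteq># S \<and> rich U \<and> size U = n)" for n
  have "P 0" unfolding P_def rich_def by (intro exI[of _ "{#}"]) simp
  moreover have "\<And>n. P n \<Longrightarrow> n \<le> size S" unfolding P_def using size_mset_mono by blast
  ultimately obtain n where n: "P n" "\<And>m. P m \<Longrightarrow> m \<le> n" using Nat.ex_has_greatest_nat[of P 0 "size S"] by metis
  obtain U where U: "U \<subseteq># S" "rich U" "size U = n" using n by (auto simp: P_def)
  let ?R = "S - U"
  have SU: "U + ?R = S" using U(1) by simp
  have "card (ssum T) \<le> (2 * p + 1) * size T" if T: "T \<subseteq># ?R" "T \<noteq> {#}" for T
  proof (rule ccontr)
    assume *: "\<not> ?thesis"
    have sub: "U + T \<subseteq># S" using T(1) U(1) SU by (metis subset_mset.add_left_mono)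
    have "card (ssum U) + card (ssum T) \<le> card (ssum (U + T)) + 1"
      by (rule card_ssum_superadditive[OF S_aper sub])
    then have "rich (U + T)" using * U(2) by (simp add: rich_def algebra_simps)
    then have "size (U + T) \<le> n" using sub by (intro n(2)) (auto simp: P_def)
    then show False using T(2) U(3) by simp
  qed
  \<comment> \<open>\<open>U\<close> has at most \<open>N / (2 * p + 1)\<close> terms, and
    \<open>1 / p - 1 / (2 * p + 1) = (p + 1) / (p * (2 * p + 1))\<close>.\<close>
  moreover have "(p + 1) * card V \<le> p * (2 * p + 1) * size ?R"
  proof -
    have "set_mset U \<subseteq> V" using S_subset set_mset_mono[OF U(1)] by (rule subset_trans[rotated])
    then have "(2 * p + 1) * size U \<le> card V" using U(2) card_ssum_le[of U] by (simp add: rich_def)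
    then have "p * ((2 * p + 1) * size U) \<le> p * card V" by (rule mult_le_mono2)
    moreover have "card V \<le> p * size S" using S_size p_dvd by (metis dvd_mult_div_cancel mult_le_mono2)
    then have "(2 * p + 1) * card V \<le> (2 * p + 1) * (p * size S)" by (rule mult_le_mono2)
    moreover have "size S = size U + size ?R" using SU by (metis size_union)
    ultimately show ?thesis by (simp add: algebra_simps)
  qed
  ultimately show ?thesis by (intro exI[of _ ?R]) auto
qed

end

section \<open>The residual sequence and its terms of high multiplicity\<close>

locale residual_seq = aperiodic_seq V p S for V :: "'a::ab_group_add set" and p S +
  fixes R :: "'a multiset"
  assumes RS: "R \<subseteq># S" and R_size: "(p + 1) * card V \<le> p * (2 * p + 1) * size R"
    and R_poor: "\<And>T. T \<subseteq># R \<Longrightarrow> T \<noteq> {#} \<Longrightarrow> card (ssum T) \<le> (2 * p + 1) * size T"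
begin

text \<open>The threshold is the number of copies of \<open>g\<close> spent in
  \<open>three_blocks\<close>; it also covers the \<open>Q - 1\<close> copies, at most
  \<open>2 * p\<close>, taken in \<open>many_sums\<close>.\<close>

definition hi :: "'a set" where
  "hi = {g \<in> set_mset R. 2 * p + 4 \<le> count R g}"

definition R' :: "'a multiset" where
  "R' = {#g \<in># R. g \<in> hi#}"

lemma hi_V: "g \<in> hi \<Longrightarrow> g \<in> V"
  using S_subset set_mset_mono[OF RS] by (auto simp: hi_def)

lemma finite_hi: "finite hi"
  by (simp add: hi_def)

lemma R'_subset: "R' \<subseteq># R" "R' \<subseteq># S"
  using RS by (auto simp: R'_def intro: subset_mset.order_trans[OF multiset_filter_subset])

lemma set_R': "set_mset R' = hi"
  by (auto simp: R'_def hi_def)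

text \<open>Otherwise \<open>distinct_growth\<close> finds a block of distinct terms violating
  \<open>R_poor\<close>.\<close>

lemma card_R: "card (set_mset R) < 6 * p ^ 3"
proof (rule ccontr)
  assume "\<not> ?thesis"
  moreover have "0 \<notin> set_mset R" using S_nonzero set_mset_mono[OF RS] by blast
  ultimately obtain T where T: "T \<subseteq> set_mset R" "T \<noteq> {}" "(2 * p + 1) * card T + 1 \<le> card (ssum (mset_set T))"
    using distinct_growth[OF p3, of "set_mset R"] by auto
  have "finite T" using T(1) finite_subset by auto
  then have "mset_set T \<subseteq># R" using T(1) by (auto simp: subseteq_mset_def count_mset_set')
  then show False using R_poor[of "mset_set T"] T \<open>finite T\<close> by (auto simp: mset_set_empty_iff)
qed

lemma size_R': "size R \<le> size R' + (2 * p + 3) * (6 * p ^ 3)"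
proof -
  have "size R = size R' + size {#g \<in># R. g \<notin> hi#}"
    unfolding R'_def by (metis multiset_partition size_union)
  moreover have "size {#g \<in># R. g \<notin> hi#} \<le> (\<Sum>g\<in>set_mset R. 2 * p + 3)"
  proof -
    have "size {#g \<in># R. g \<notin> hi#} = (\<Sum>g\<in>set_mset {#g \<in># R. g \<notin> hi#}. count {#g \<in># R. g \<notin> hi#} g)"
      by (rule size_multiset_overloaded_eq)
    also have "\<dots> \<le> (\<Sum>g\<in>set_mset {#g \<in># R. g \<notin> hi#}. 2 * p + 3)"
      by (rule sum_mono) (auto simp: hi_def)
    also have "\<dots> \<le> (\<Sum>g\<in>set_mset R. 2 * p + 3)" by (rule sum_mono2) auto
    finally show ?thesis .
  qed
  moreover have "(\<Sum>g\<in>set_mset R. 2 * p + 3) \<le> (2 * p + 3) * (6 * p ^ 3)"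
    using card_R by (simp add: mult.commute del: mult_Suc_right)
  ultimately show ?thesis by linarith
qed

lemma powers: "3 * p ^ n \<le> p ^ Suc n"
  using p3 by simp

lemma R'_size:
  "(p + 1) * card V \<le> p * (2 * p + 1) * size R' + (24 * p ^ 6 + 48 * p ^ 5 + 18 * p ^ 4)"
proof -
  have "p * (2 * p + 1) * size R \<le> p * (2 * p + 1) * (size R' + (2 * p + 3) * (6 * p ^ 3))"
    using size_R' by (rule mult_le_mono2)
  also have "\<dots> = p * (2 * p + 1) * size R' + (24 * p ^ 6 + 48 * p ^ 5 + 18 * p ^ 4)"
    by (rule power_identities)
  finally show ?thesis using R_size by linarith
qed

text \<open>If \<open>hi\<close> lay in one cyclic group, regularity would leave \<open>R'\<close>
  fewer than \<open>N / (2 * p + 1)\<close> terms, too few by about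
  \<open>N / (p * (2 * p + 1))\<close>.\<close>

lemma hi_outside:
  assumes x: "x \<in> V" shows "\<exists>h\<in>hi. h \<notin> cyc x"
proof (rule ccontr)
  assume *: "\<not> ?thesis"
  have "count R' y = 0" if "y \<notin> cyc x" for y
    using * that set_R' by (metis not_in_iff)
  then have "R' = {#y \<in># R'. y \<in> cyc x#}" by (intro multiset_eqI) simp
  then have "size R' \<le> size {#y \<in># S. y \<in> cyc x#}"
    using R'_subset by (metis multiset_filter_mono size_mset_mono)
  then have "size R' \<le> card (cyc x)" using S_cyc[OF x] by linarith
  then have "(2 * p + 1) * size R' \<le> card V" using card_cyc[OF x] mult_le_mono2 order_trans by blast
  then have "p * ((2 * p + 1) * size R') \<le> p * card V" by (rule mult_le_mono2)
  then have "card V \<le> 24 * p ^ 6 + 48 * p ^ 5 + 18 * p ^ 4" using R'_size by (simp add: algebra_simps)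
  moreover have "3 * p ^ 5 \<le> p ^ 6" "3 * p ^ 4 \<le> p ^ 5" "0 < p ^ 6" using powers[of 5] powers[of 4] p3 by simp_all
  ultimately show False using big by linarith
qed

text \<open>
  Otherwise \<open>2 * p + 4\<close> copies of \<open>g\<close> and \<open>p - 1\<close> copies of each of \<open>h\<close> and \<open>u\<close> form a block with
  \<open>p\<^sup>2 * (2 * p + 5)\<close> sums, too many for a subsequence of \<open>R\<close>.
\<close>

lemma three_blocks:
  assumes g: "g \<in> hi" and h: "h \<in> hi" "h \<notin> cyc g" and u: "u \<in> hi"
  shows "u \<in> cyc g + cyc h"
proof (rule ccontr)
  assume nu: "u \<notin> cyc g + cyc h"
  note V' = hi_V[OF g] hi_V[OF h(1)] hi_V[OF u]
  have cg: "subgrp (cyc g)" and ch: "subgrp (cyc h)" using subgrp_cyc[OF V finV] V' by auto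
  have sgh: "subgrp (cyc g + cyc h)" using cg ch by (rule subgrp_sumset)
  have sub: "cyc g \<subseteq> cyc g + cyc h" "cyc h \<subseteq> cyc g + cyc h"
    using subset_sumset[OF ch, of "cyc g"] subset_sumset[OF cg, of "cyc h"] by (simp_all add: add.commute)
  have neq: "g \<noteq> h" "g \<noteq> u" "h \<noteq> u" using h nu sub mem_cyc[of g] mem_cyc[of h] by auto
  define T where "T = replicate_mset (2 * p + 4) g"
  define T1 where "T1 = T + replicate_mset (p - 1) h"
  define T2 where "T2 = T1 + replicate_mset (p - 1) u"
  have T2R: "T2 \<subseteq># R" using g h u neq unfolding T2_def T1_def T_def hi_def
    by (auto simp: subseteq_mset_def)
  then have T2S: "T2 \<subseteq># S" using RS subset_mset.order_trans by blast
  have "T \<subseteq># T2" unfolding T2_def T1_def by simp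
  then have "T \<subseteq># S" using T2S subset_mset.order_trans by blast
  then have c0: "2 * p + 5 \<le> card (ssum T)"
    using card_ssum_ge_size[OF S_aper S_nonzero] by (fastforce simp: T_def)
  have c1: "p * card (ssum T) \<le> card (ssum T1)" unfolding T1_def
    using card_ssum_replicate[OF cg, of T p h] nmul_notin[OF cg V'(2) h(2)] mem_cyc[of g] p3 by (auto simp: T_def)
  have "set_mset T1 \<subseteq> cyc g + cyc h"
    using sub mem_cyc[of g] mem_cyc[of h] by (auto simp: T1_def T_def)
  then have c2: "p * card (ssum T1) \<le> card (ssum T2)" unfolding T2_def
    using card_ssum_replicate[OF sgh, of T1 p u] nmul_notin[OF sgh V'(3) nu] p3 by auto
  have "p * (p * (2 * p + 5)) \<le> card (ssum T2)"
    using c0 c1 c2 by (meson mult_le_mono2 order_trans)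
  also have "\<dots> \<le> (2 * p + 1) * size T2" by (rule R_poor[OF T2R]) (simp add: T2_def T1_def T_def)
  also have "size T2 = 4 * p + 2" using p3 by (simp add: T2_def T1_def T_def)
  finally have "p * (p * (2 * p + 5)) \<le> (2 * p + 1) * (4 * p + 2)" .
  \<comment> \<open>At \<open>p = 3\<close> the inequality to refute reads 99 <= 98, so
    \<open>2 * p + 4\<close> copies are just enough.\<close>
  moreover obtain d where "p = 3 + d" using p3 le_Suc_ex by blast
  ultimately show False by (simp add: algebra_simps)
qed

text \<open>If \<open>g\<close> were not in \<open>cyc h\<close>, \<open>three_blocks\<close> would
  confine \<open>hi\<close> to \<open>cyc h + cyc g = cyc g\<close>, against
  \<open>hi_outside\<close>. Thus \<open>hi\<close> splits into classes of elements generating the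
  same cyclic group.\<close>

lemma cyc_eq:
  assumes g: "g \<in> hi" and h: "h \<in> hi" "h \<in> cyc g" shows "cyc h = cyc g"
proof
  note cg = subgrp_cyc[OF V finV hi_V[OF g]]
  show hg: "cyc h \<subseteq> cyc g" using cyc_subset[OF cg h(2)] .
  have "g \<in> cyc h"
  proof (rule ccontr)
    assume ng: "g \<notin> cyc h"
    obtain u where u: "u \<in> hi" "u \<notin> cyc g" using hi_outside[OF hi_V[OF g]] by blast
    have "u \<in> cyc h + cyc g" by (rule three_blocks[OF h(1) g ng u(1)])
    also have "\<dots> \<subseteq> cyc g" using sumset_mono[OF hg order_refl[of "cyc g"]] by (simp add: subgrp_sumset_self[OF cg])
    finally show False using u by simp
  qed
  then show "cyc g \<subseteq> cyc h" using cyc_subset subgrp_cyc[OF V finV hi_V[OF h(1)]] by blast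
qed

text \<open>
  \<open>Q = p\<close> comes from \<open>p\<close> being the least prime divisor; if \<open>H = V\<close>, then \<open>cyc g + cyc h = V\<close> and the
  index of \<open>cyc g\<close> is at least \<open>2 * p + 1\<close>.
\<close>

lemma hull_exists:
  "\<exists>H Q. subgrp H \<and> hi \<subseteq> H \<and> H \<subseteq> V \<and> (H = V \<and> Q = 2 * p + 1 \<or> p * card H \<le> card V \<and> Q = p) \<and>
     (\<forall>g\<in>hi. \<forall>h\<in>hi. h \<notin> cyc g \<longrightarrow> (\<forall>i. 0 < i \<longrightarrow> i < Q \<longrightarrow> nmul i h \<notin> cyc g))"
proof -
  obtain g1 where g1: "g1 \<in> hi" using hi_outside[OF subgrp_zero[OF V]] by blast
  obtain h1 where h1: "h1 \<in> hi" "h1 \<notin> cyc g1" using hi_outside[OF hi_V[OF g1]] by blast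
  define H where "H = cyc g1 + cyc h1"
  have sub_cyc: "subgrp (cyc g)" if "g \<in> hi" for g using subgrp_cyc[OF V finV hi_V[OF that]] .
  have sH: "subgrp H" unfolding H_def using sub_cyc g1 h1 by (intro subgrp_sumset)
  have HV: "H \<subseteq> V"
    using sumset_mono[OF cyc_subset[OF V hi_V[OF g1]] cyc_subset[OF V hi_V[OF h1(1)]]]
    by (simp add: H_def subgrp_sumset_self[OF V])
  have hiH: "hi \<subseteq> H" unfolding H_def using three_blocks[OF g1 h1] by blast
  show ?thesis
  proof (cases "H = V")
    case False
    then have "p * card H \<le> card V" using card_proper[OF sH HV] by simp
    then show ?thesis
      using sH hiH HV nmul_notin[OF sub_cyc hi_V] by (intro exI[of _ H] exI[of _ p]) blast
  next
    case True
    \<comment> \<open>\<open>three_blocks\<close> gives \<open>cyc g + cyc h = V\<close>. If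
      \<open>nmul i h\<close> were in \<open>cyc g\<close>, then \<open>i\<close> cosets of
      \<open>cyc g\<close> would cover \<open>V\<close>, but \<open>i \<le> 2 * p\<close> is below
      its index.\<close>
    have "nmul i h \<notin> cyc g" if gh: "g \<in> hi" "h \<in> hi" "h \<notin> cyc g" and i: "0 < i" "i < 2 * p + 1" for g h i
    proof
      assume ni: "nmul i h \<in> cyc g"
      note cg = sub_cyc[OF gh(1)]
      have sgh: "subgrp (cyc g + cyc h)" using sub_cyc gh by (intro subgrp_sumset)
      have "cyc g1 \<subseteq> cyc g + cyc h" "cyc h1 \<subseteq> cyc g + cyc h"
        using three_blocks[OF gh] g1 h1 by (auto intro!: cyc_subset[OF sgh])
      then have "V \<subseteq> cyc g + cyc h"
        using sumset_mono[of "cyc g1" "cyc g + cyc h" "cyc h1" "cyc g + cyc h"] True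
        by (simp add: H_def subgrp_sumset_self[OF sgh])
      also have "\<dots> \<subseteq> (\<Union>j<i. {nmul j h} + cyc g)"
      proof
        fix z assume "z \<in> cyc g + cyc h"
        then obtain a m where a: "a \<in> cyc g" and z: "z = a + nmul m h" by (auto simp: mem_sumset cyc_def[of h])
        have "nmul m h = nmul (m div i * i + m mod i) h" by simp
        also have "\<dots> = nmul (m div i) (nmul i h) + nmul (m mod i) h" by (simp only: nmul_add nmul_mult)
        finally have "z = nmul (m mod i) h + (a + nmul (m div i) (nmul i h))" by (simp add: z ac_simps)
        moreover have "a + nmul (m div i) (nmul i h) \<in> cyc g" by (intro subgrp_plus[OF cg a] nmul_mem[OF cg ni])
        ultimately have "z \<in> {nmul (m mod i) h} + cyc g" by auto
        then show "z \<in> (\<Union>j<i. {nmul j h} + cyc g)" using i by auto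
      qed
      finally have sub: "V \<subseteq> (\<Union>j<i. {nmul j h} + cyc g)" .
      have fin: "finite (cyc g)" using finite_subgrp[OF cyc_subset[OF V hi_V[OF gh(1)]]] .
      have "card V \<le> card (\<Union>j<i. {nmul j h} + cyc g)" using fin by (intro card_mono[OF _ sub]) auto
      also have "\<dots> \<le> (\<Sum>j<i. card ({nmul j h} + cyc g))" by (rule card_UN_le) simp
      also have "\<dots> = i * card (cyc g)" by simp
      also have "\<dots> \<le> 2 * p * card (cyc g)" using i by (intro mult_le_mono1) simp
      finally have "(2 * p + 1) * card (cyc g) \<le> 2 * p * card (cyc g)"
        using card_cyc[OF hi_V[OF gh(1)]] by linarith
      then show False using fin mem_cyc[of g] by (auto simp: card_gt_0_iff)
    qed
    then show ?thesis using sH hiH HV True by (intro exI[of _ H] exI[of _ "2 * p + 1"]) auto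
  qed
qed

text \<open>
  The terms of each class \<open>c\<close> of generators of one cyclic group are combined with \<open>Q - 1\<close> copies of an
  element of the class \<open>f c\<close>, which multiplies the number of sums by \<open>Q\<close>. As \<open>f\<close> is a permutation, no
  class has to supply more than \<open>Q - 1\<close> such copies.
\<close>

lemma many_sums:
  assumes Q: "1 \<le> Q" "Q \<le> 2 * p + 1"
    and rel: "\<And>g h i. g \<in> hi \<Longrightarrow> h \<in> hi \<Longrightarrow> h \<notin> cyc g \<Longrightarrow> 0 < i \<Longrightarrow> i < Q \<Longrightarrow> nmul i h \<notin> cyc g"
  shows "Q * size R' + 1 \<le> card (ssum R') + 6 * p ^ 3 * (Q - 1)\<^sup>2"
proof -
  define C where "C = cyc ` hi"
  define rep where "rep c = (SOME g. g \<in> hi \<and> cyc g = c)" for c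
  define cl where "cl c = {#x \<in># R'. cyc x = c#}" for c
  have finC: "finite C" using finite_hi by (simp add: C_def)
  have "C \<subseteq> cyc ` set_mset R" by (auto simp: C_def hi_def)
  then have "card C \<le> card (cyc ` set_mset R)" by (intro card_mono) auto
  then have cardC: "card C \<le> 6 * p ^ 3" using card_image_le[of "set_mset R" cyc] card_R by simp
  have rep: "rep c \<in> hi" "cyc (rep c) = c" if "c \<in> C" for c
  proof -
    have "\<exists>g. g \<in> hi \<and> cyc g = c" using that by (auto simp: C_def)
    then have "rep c \<in> hi \<and> cyc (rep c) = c" unfolding rep_def by (rule someI_ex)
    then show "rep c \<in> hi" "cyc (rep c) = c" by auto
  qed
  have "2 \<le> card C"
  proof -
    obtain g where g: "g \<in> hi" using hi_outside[OF subgrp_zero[OF V]] by blast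
    obtain h where h: "h \<in> hi" "h \<notin> cyc g" using hi_outside[OF hi_V[OF g]] by blast
    have "cyc h \<noteq> cyc g" using h mem_cyc by blast
    then have "card {cyc h, cyc g} = 2" by simp
    moreover have "card {cyc h, cyc g} \<le> card C" using g h finC by (intro card_mono) (auto simp: C_def)
    ultimately show ?thesis by simp
  qed
  then obtain f where f: "bij_betw f C C" "\<And>c. c \<in> C \<Longrightarrow> f c \<noteq> c"
    using fixpoint_free_permutation[OF finC] by blast
  have fC: "f c \<in> C" if "c \<in> C" for c using f(1) that by (auto dest: bij_betwE)
  define rs where "rs c = replicate_mset (Q - 1) (rep c)" for c
  define B where "B c = (cl c - rs c) + rs (f c)" for c
  have rs_cl: "rs c \<subseteq># cl c" if "c \<in> C" for c
    using rep[OF that] Q by (auto simp: subseteq_mset_def rs_def cl_def R'_def hi_def)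
  have "(\<Sum>c\<in>C. B c) = (\<Sum>c\<in>C. cl c - rs c) + (\<Sum>c\<in>C. rs (f c))" by (simp add: B_def sum.distrib)
  also have "(\<Sum>c\<in>C. rs (f c)) = (\<Sum>c\<in>C. rs c)" using sum.reindex_bij_betw[OF f(1)] .
  also have "(\<Sum>c\<in>C. cl c - rs c) + (\<Sum>c\<in>C. rs c) = (\<Sum>c\<in>C. cl c - rs c + rs c)" by (simp add: sum.distrib)
  also have "\<dots> = (\<Sum>c\<in>C. cl c)" by (rule sum.cong) (use rs_cl in auto)
  also have cl_sum: "\<dots> = R'" unfolding cl_def by (rule sum_filter_classes[OF finC]) (auto simp: C_def set_R')
  finally have B_sum: "(\<Sum>c\<in>C. B c) = R'" .
  \<comment> \<open>\<open>?T\<close> has \<open>size (cl c) - (Q - 1)\<close> terms and at least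
    one sum more than that, so multiplying by \<open>Q\<close> leaves a loss of
    \<open>Q * Q - 2 * Q\<close>. Superadditivity costs one more per class, in all
    \<open>(Q - 1)\<^sup>2\<close>.\<close>
  have block: "Q * size (cl c) + 2 * Q \<le> card (ssum (B c)) + Q * Q" if c: "c \<in> C" for c
  proof -
    let ?T = "cl c - rs c"
    have sc: "subgrp c" using subgrp_cyc[OF V finV hi_V[OF rep(1)[OF c]]] by (simp only: rep(2)[OF c])
    have Tc: "set_mset ?T \<subseteq> c"
    proof
      fix x assume "x \<in># ?T"
      then have "x \<in># cl c" by (rule in_diffD)
      then show "x \<in> c" using mem_cyc[of x] by (auto simp: cl_def)
    qed
    have "rep (f c) \<notin> c"
    proof
      assume "rep (f c) \<in> c"
      then have "rep (f c) \<in> cyc (rep c)" by (simp only: rep(2)[OF c])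
      then have "cyc (rep (f c)) = cyc (rep c)" by (rule cyc_eq[OF rep(1)[OF c] rep(1)[OF fC[OF c]]])
      then show False using f(2)[OF c] by (simp only: rep(2)[OF c] rep(2)[OF fC[OF c]])
    qed
    then have "nmul i (rep (f c)) \<notin> c" if "0 < i" "i < Q" for i
      using rel[OF rep(1)[OF c] rep(1)[OF fC[OF c]], unfolded rep(2)[OF c]] that by blast
    from card_ssum_replicate[OF sc Tc this] have "Q * card (ssum ?T) \<le> card (ssum (B c))"
      using Q(1) by (simp only: B_def rs_def)
    moreover have "cl c \<subseteq># R'" by (simp add: cl_def)
    then have "?T \<subseteq># S"
      using R'_subset(2) by (meson diff_subset_eq_self subset_mset.order_trans)
    then have "size ?T + 1 \<le> card (ssum ?T)" by (rule card_ssum_ge_size[OF S_aper S_nonzero])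
    then have "Q * (size ?T + 1) \<le> Q * card (ssum ?T)" by (rule mult_le_mono2)
    moreover have "size (cl c) = size ?T + (Q - 1)"
      using rs_cl[OF c] size_mset_mono[OF rs_cl[OF c]] by (simp add: size_Diff_submset rs_def)
    then have "Q * size (cl c) + 2 * Q = Q * (size ?T + 1) + Q * Q" using Q by (cases Q) (simp_all add: algebra_simps)
    ultimately show ?thesis by linarith
  qed
  have "size (\<Sum>c\<in>C. cl c) = (\<Sum>c\<in>C. size (cl c))" using finC by induction auto
  then have size: "(\<Sum>c\<in>C. size (cl c)) = size R'" by (simp only: cl_sum)
  have "(\<Sum>c\<in>C. Q * size (cl c) + 2 * Q) \<le> (\<Sum>c\<in>C. card (ssum (B c)) + Q * Q)" by (rule sum_mono) (rule block)
  then have 1: "Q * size R' + card C * (2 * Q) \<le> (\<Sum>c\<in>C. card (ssum (B c))) + card C * (Q * Q)"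
    by (simp only: sum.distrib sum_constant of_nat_id size flip: sum_distrib_left)
  have 2: "(\<Sum>c\<in>C. card (ssum (B c))) + 1 \<le> card (ssum R') + card C"
    using card_ssum_sum[OF S_aper finC, of B] R'_subset(2) by (simp only: B_sum)
  obtain q where "Q = Suc q" using Q(1) by (cases Q) auto
  then have "card C * (Q * Q) + card C = (Q - 1)\<^sup>2 * card C + card C * (2 * Q)"
    by (simp add: power2_eq_square algebra_simps)
  then have "Q * size R' + 1 \<le> card (ssum R') + (Q - 1)\<^sup>2 * card C" using 1 2 by linarith
  moreover have "(Q - 1)\<^sup>2 * card C \<le> 6 * p ^ 3 * (Q - 1)\<^sup>2" using cardC by (simp add: mult.commute)
  ultimately show ?thesis by linarith
qed

text \<open>Up to errors the count gives \<open>(p + 1) * N \<le> p * N\<close> if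
  \<open>H = V\<close>, and \<open>p * (p + 1) * N \<le> (2 * p + 1) * N\<close> otherwise. The
  errors are at most \<open>66 * p ^ 6\<close> against a slack of \<open>N\<close>, and at most
  \<open>56 * p ^ 7\<close> against a slack of at least \<open>p * N\<close>; the bound
  \<open>72 * p ^ 6\<close> covers both.\<close>

lemma contradiction: False
proof -
  obtain H Q where H: "subgrp H" "hi \<subseteq> H" "H \<subseteq> V"
    and HQ: "H = V \<and> Q = 2 * p + 1 \<or> p * card H \<le> card V \<and> Q = p"
    and rel: "\<And>g h i. g \<in> hi \<Longrightarrow> h \<in> hi \<Longrightarrow> h \<notin> cyc g \<Longrightarrow> 0 < i \<Longrightarrow> i < Q \<Longrightarrow> nmul i h \<notin> cyc g"
    using hull_exists by blast
  have "1 \<le> Q" "Q \<le> 2 * p + 1" using HQ p3 by auto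
  then have "Q * size R' + 1 \<le> card (ssum R') + 6 * p ^ 3 * (Q - 1)\<^sup>2" using rel by (rule many_sums)
  moreover have "card (ssum R') \<le> card H"
    using H finite_subgrp by (intro card_mono ssum_subset) (auto simp: set_R')
  ultimately have main: "Q * size R' \<le> card H + 6 * p ^ 3 * (Q - 1)\<^sup>2" by linarith
  have pw: "3 * p ^ 4 \<le> p ^ 5" "3 * p ^ 5 \<le> p ^ 6" "3 * p ^ 6 \<le> p ^ 7" "0 < p ^ 6"
    using powers[of 4] powers[of 5] powers[of 6] p3 by simp_all
  from HQ show False
  proof
    assume *: "H = V \<and> Q = 2 * p + 1"
    then have "p * ((2 * p + 1) * size R') \<le> p * (card V + 6 * p ^ 3 * (2 * p)\<^sup>2)" using main by (intro mult_le_mono2) simp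
    also have "\<dots> = p * card V + 24 * p ^ 6" by (rule power_identities)
    finally have "card V \<le> 48 * p ^ 6 + 48 * p ^ 5 + 18 * p ^ 4" using R'_size by (simp add: algebra_simps)
    then show False using big pw by linarith
  next
    assume *: "p * card H \<le> card V \<and> Q = p"
    have "(p - 1)\<^sup>2 \<le> p\<^sup>2" by (rule power_mono) auto
    then have "p * size R' \<le> card H + 6 * p ^ 3 * p\<^sup>2" using main * by (meson add_left_mono mult_le_mono2 order_trans)
    then have "p * (2 * p + 1) * (p * size R') \<le> p * (2 * p + 1) * (card H + 6 * p ^ 3 * p\<^sup>2)" by (rule mult_le_mono2)
    also have "\<dots> = (2 * p + 1) * (p * card H) + (12 * p ^ 7 + 6 * p ^ 6)" by (rule power_identities)
    also have "\<dots> \<le> (2 * p + 1) * card V + (12 * p ^ 7 + 6 * p ^ 6)" using * by (intro add_mono mult_le_mono2) auto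
    finally have 1: "p * (p * (2 * p + 1) * size R') \<le> (2 * p + 1) * card V + (12 * p ^ 7 + 6 * p ^ 6)"
      by (simp only: ac_simps)
    have "p * ((p + 1) * card V) \<le> p * (p * (2 * p + 1) * size R' + (24 * p ^ 6 + 48 * p ^ 5 + 18 * p ^ 4))"
      using R'_size by (rule mult_le_mono2)
    also have "\<dots> = p * (p * (2 * p + 1) * size R') + (24 * p ^ 7 + 48 * p ^ 6 + 18 * p ^ 5)"
      by (rule power_identities)
    finally have 2: "p * ((p + 1) * card V) \<le> (2 * p + 1) * card V + (36 * p ^ 7 + 54 * p ^ 6 + 18 * p ^ 5)"
      using 1 by linarith
    have "(3 * p + 1) * card V \<le> p * ((p + 1) * card V)"
    proof -
      have "3 * p \<le> p * p" using p3 by (rule mult_le_mono1)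
      moreover have "p * (p + 1) = p * p + p" by simp
      ultimately have "3 * p + 1 \<le> p * (p + 1)" using p3 by linarith
      then show ?thesis using mult_le_mono1 by (metis mult.assoc)
    qed
    then have "p * card V \<le> 36 * p ^ 7 + 54 * p ^ 6 + 18 * p ^ 5" using 2 by (simp add: algebra_simps)
    moreover have "72 * p ^ 7 \<le> p * card V"
    proof -
      have "p * (72 * p ^ 6) = 72 * p ^ 7" by (rule power_identities)
      then show ?thesis using mult_le_mono2[OF big, of p] by (simp only:)
    qed
    ultimately show False using pw by linarith
  qed
qed

end

lemma (in aperiodic_seq) contradiction: False
proof -
  obtain R where R: "R \<subseteq># S" "(p + 1) * card V \<le> p * (2 * p + 1) * size R"
    "\<And>T. T \<subseteq># R \<Longrightarrow> T \<noteq> {#} \<Longrightarrow> card (ssum T) \<le> (2 * p + 1) * size T"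
    using residual_exists by blast
  then interpret residual_seq V p S R by unfold_locales
  show False by (rule contradiction)
qed

section \<open>Zero-sum free sequences\<close>

definition zero_sum_free :: "'a::comm_monoid_add multiset \<Rightarrow> bool" where
  "zero_sum_free S \<longleftrightarrow> (\<forall>T. T \<subseteq># S \<longrightarrow> T \<noteq> {#} \<longrightarrow> sum_mset T \<noteq> 0)"

lemma zero_sum_free_subset: "zero_sum_free S \<Longrightarrow> T \<subseteq># S \<Longrightarrow> zero_sum_free T"
  unfolding zero_sum_free_def using subset_mset.order_trans[of _ T S] by simp

lemma zero_sum_free_minus:
  fixes S :: "'a::ab_group_add multiset"
  assumes "zero_sum_free (add_mset x S)" shows "- x \<notin> ssum S"
proof
  assume "- x \<in> ssum S"
  then obtain T where T: "T \<subseteq># S" "sum_mset T = - x" by (auto simp: ssum_def)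
  then have "sum_mset (add_mset x T) = 0" by simp
  moreover have "add_mset x T \<subseteq># add_mset x S" using T(1) by simp
  ultimately show False
    using assms[unfolded zero_sum_free_def, rule_format, of "add_mset x T"] by simp
qed

text \<open>A term \<open>x\<close> that adds no new sum stabilizes the sum set, and so does
  \<open>- x\<close>; then \<open>- x\<close> is itself a sum, which \<open>x\<close> completes to
  zero.\<close>

lemma zero_sum_free_growth:
  fixes U :: "'a::ab_group_add multiset"
  assumes "zero_sum_free (U + W)" shows "card (ssum U) + size W \<le> card (ssum (U + W))"
  using assms
proof (induction W)
  case (add x W)
  let ?B = "ssum (U + W)"
  have "zero_sum_free (U + W)" using add.prems by (rule zero_sum_free_subset) simp
  then have IH: "card (ssum U) + size W \<le> card ?B" by (rule add.IH)
  have "\<not> {x} + ?B \<subseteq> ?B"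
  proof
    assume "{x} + ?B \<subseteq> ?B"
    then have "x \<in> stab ?B" by (intro stabI) simp
    then have "- x \<in> stab ?B" by (rule subgrp_minus[OF subgrp_stab])
    then have "- x + 0 \<in> ?B" by (rule stab_translate[OF _ zero_in_ssum])
    then show False using zero_sum_free_minus[of x "U + W"] add.prems by simp
  qed
  then have "?B \<subset> ?B \<union> ({x} + ?B)" by blast
  then have "card ?B < card (?B \<union> ({x} + ?B))" by (intro psubset_card_mono) simp_all
  then show ?case using IH by (simp add: ssum_add_mset)
qed simp

text \<open>Two different terms \<open>x\<close>, \<open>y\<close> have the four sums
  \<open>0\<close>, \<open>x\<close>, \<open>y\<close>, \<open>x + y\<close>, one more than the
  growth by one per term accounts for, and the total would exceed \<open>card K\<close>. So only one
  value occurs, and it generates \<open>K\<close>.\<close>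

lemma zero_sum_free_maximal:
  fixes T :: "'a::ab_group_add multiset"
  assumes K: "subgrp K" "finite K" and T: "set_mset T \<subseteq> K" "zero_sum_free T"
    and size: "size T + 1 = card K" "2 \<le> card K"
  shows "ssum T = K" "\<exists>x\<in>K. card K \<le> card (cyc x)"
proof -
  have sub: "ssum T \<subseteq> K" using ssum_subset[OF K(1) T(1)] .
  have ge: "card K \<le> card (ssum T)" using zero_sum_free_growth[of "{#}" T] T(2) size(1) by simp
  then show "ssum T = K" by (rule card_seteq[OF K(2) sub])
  have "0 < size T" using size by linarith
  then have "T \<noteq> {#}" by (simp only: nonempty_has_size)
  then obtain x where x: "x \<in># T" by blast
  have "set_mset T \<subseteq> {x}"
  proof (rule ccontr)
    assume "\<not> ?thesis"
    then obtain y where y: "y \<in># T" "y \<noteq> x" by blast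
    obtain T1 where T1: "T = add_mset x T1" using x by (rule mset_add)
    have "y \<in># T1" using y T1 by simp
    then obtain W where "T1 = add_mset y W" by (rule mset_add)
    then have W: "T = {#x, y#} + W" using T1 by simp
    have "zero_sum_free {#x, y#}" using T(2) unfolding W by (rule zero_sum_free_subset) simp
    then have "sum_mset U \<noteq> 0" if "U \<subseteq># {#x, y#}" "U \<noteq> {#}" for U
      using that by (simp add: zero_sum_free_def)
    from this[of "{#x#}"] this[of "{#y#}"] this[of "{#x, y#}"]
    have nz: "x \<noteq> 0" "y \<noteq> 0" "x + y \<noteq> 0" by simp_all
    have "{x} + {0, y} = {x, x + y}" by (auto simp: mem_sumset)
    then have "ssum {#x, y#} = {0, x, y, x + y}" by (simp add: ssum_add_mset[of x "{#y#}"] insert_commute)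
    also have "card {0, x, y, x + y} = 4" using nz y(2) by auto
    finally have "4 + size W \<le> card (ssum T)" using zero_sum_free_growth[of "{#x, y#}" W] T(2) unfolding W by simp
    also have "\<dots> \<le> card K" using K(2) sub by (rule card_mono)
    finally show False using size(1) unfolding W by simp
  qed
  have xK: "x \<in> K" using x T(1) by blast
  have "set_mset T \<subseteq> cyc x" using \<open>set_mset T \<subseteq> {x}\<close> mem_cyc[of x] by blast
  then have "ssum T \<subseteq> cyc x" by (rule ssum_subset[OF subgrp_cyc[OF K xK]])
  then have "card (ssum T) \<le> card (cyc x)"
    using finite_subset[OF cyc_subset[OF K(1) xK] K(2)] by (rule card_mono[rotated])
  then show "\<exists>x\<in>K. card K \<le> card (cyc x)" using ge xK by (intro bexI[of _ x]) simp
qed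

section \<open>Zero as the sum of a nonempty subsequence\<close>

context small_exponent_group
begin

lemma not_aperiodic:
  assumes "regular_in V S" "card V div p \<le> size S" shows "stab (ssum S) \<noteq> {0}"
proof
  assume "stab (ssum S) = {0}"
  then interpret aperiodic_seq V p S by unfold_locales (use assms in auto)
  show False by (rule contradiction)
qed

lemma V_div: "card V = p * (card V div p)"
  using p_dvd by simp

lemma index_large: "2 * p < card V div p"
proof -
  have "p * (2 * p) \<le> p ^ 6 * 2"
    using power_increasing[of 2 6 p] p3 by (simp add: power2_eq_square)
  moreover have "0 < p ^ 6" using p3 by simp
  ultimately have "p * (2 * p) < p * (card V div p)" using big V_div by linarith
  then show ?thesis by simp
qed

lemma p_less: "p < card V"
proof -
  have "p < card V div p" using index_large by simp
  also have "\<dots> \<le> card V" by simp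
  finally show ?thesis .
qed

text \<open>Equality case of the count in \<open>periodic_imp_full\<close>, one term short.\<close>

lemma almost_full:
  assumes S: "regular_in V S" and size: "card V div p + p - 3 \<le> size S" and ne: "ssum S \<noteq> V"
  defines "K \<equiv> stab (ssum S)"
  shows "subgrp K" "K \<subseteq> V" "size {#s \<in># S. s \<in> K#} + 1 = card K" "card K = p \<or> p * card K = card V"
proof -
  have "card V div p \<le> size S" using size p3 by linarith
  then have K0: "K \<noteq> {0}" unfolding K_def by (rule not_aperiodic[OF S])
  note K = stab_size[OF S K_def[THEN meta_eq_to_obj_eq] K0 ne]
  show "subgrp K" "K \<subseteq> V" using K by auto
  obtain u where u: "card K = p + u" using K(6) le_Suc_ex by blast
  have "card K \<le> card V div p" using K(7) V_div p3 by (metis mult_le_cancel1 not_numeral_le_zero zero_less_iff_neq_zero)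
  then obtain v where v: "card V div p = card K + v" using le_Suc_ex by blast
  have upper: "card K * (2 + (size S - size {#s \<in># S. s \<in> K#})) \<le> p * (card K + v)"
    using K(4) V_div v by simp
  show "size {#s \<in># S. s \<in> K#} + 1 = card K"
  proof (rule ccontr)
    assume "\<not> ?thesis"
    then have "v + p + 1 \<le> 2 + (size S - size {#s \<in># S. s \<in> K#})" using size K(5) v p3 by linarith
    then have "card K * (v + p + 1) \<le> card K * (2 + (size S - size {#s \<in># S. s \<in> K#}))" by (rule mult_le_mono2)
    also note upper
    finally have "p * v + u * v + p + u \<le> p * v" unfolding u by (simp add: algebra_simps)
    then show False using p3 by simp
  qed
  \<comment> \<open>Here the count is tight and leaves \<open>u * v = 0\<close>: the order of
    \<open>K\<close> is one of the extremes \<open>p\<close> and \<open>N / p\<close>.\<close>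
  have "v + p \<le> 2 + (size S - size {#s \<in># S. s \<in> K#})" using size K(5) v p3 by linarith
  then have "card K * (v + p) \<le> card K * (2 + (size S - size {#s \<in># S. s \<in> K#}))" by (rule mult_le_mono2)
  also note upper
  finally have "u * v = 0" unfolding u by (simp add: algebra_simps)
  then show "card K = p \<or> p * card K = card V" using u v V_div by auto
qed

text \<open>
  If \<open>S\<close> is zero-sum free, then for each term \<open>s\<close> the stabilizer \<open>K s\<close> of the sums of \<open>S - {#s#}\<close> has
  order \<open>p\<close>, is filled by the sums of the terms lying in it, and does not contain \<open>s\<close>. For \<open>s2\<close> in
  \<open>K s1\<close> and \<open>s3\<close> outside both groups, \<open>K s3\<close> contains the distinct groups \<open>K s1\<close> and \<open>K s2\<close>.
\<close>

lemma zero_sum: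
  assumes S: "regular_in V S" and size: "card V div p + p - 2 \<le> size S"
  shows "\<not> zero_sum_free S"
proof
  assume zf: "zero_sum_free S"
  have SV: "set_mset S \<subseteq> V" using S by (simp add: regular_in_def)
  define K where "K s = stab (ssum (S - {#s#}))" for s
  define T where "T s = {#y \<in># S - {#s#}. y \<in> K s#}" for s
  have TS: "T s \<subseteq># S" for s
    unfolding T_def by (rule subset_mset.order_trans[OF multiset_filter_subset diff_subset_eq_self])
  have K: "subgrp (K s)" "K s \<subseteq> V" "card (K s) = p" "s \<notin> K s" "ssum (T s) = K s" "size (T s) + 1 = p"
    if s: "s \<in># S" for s
  proof -
    have S': "regular_in V (S - {#s#})" using S by (rule regular_in_subset) simp
    have size': "card V div p + p - 3 \<le> size (S - {#s#})" using size s by (simp add: size_Diff_singleton)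
    have "- s \<notin> ssum (S - {#s#})" using zero_sum_free_minus[of s "S - {#s#}"] zf s by simp
    moreover have "- s \<in> V" using subgrp_minus[OF V] SV s by blast
    ultimately have ne: "ssum (S - {#s#}) \<noteq> V" by blast
    note * = almost_full[OF S' size' ne, folded K_def, folded T_def]
    show 1: "subgrp (K s)" "K s \<subseteq> V" using * by auto
    have p_le: "p \<le> card (K s)"
      using *(4)
    proof
      assume "p * card (K s) = card V"
      then have "p * card (K s) = p * (card V div p)" by (simp only: V_div[symmetric])
      then show ?thesis using index_large p3 by simp
    qed simp
    have zfT: "zero_sum_free (T s)"
      using zf TS by (rule zero_sum_free_subset)
    note max = zero_sum_free_maximal[OF 1(1) finite_subgrp[OF 1(2)] _ zfT *(3)]
    have TK: "set_mset (T s) \<subseteq> K s" unfolding T_def set_mset_filter by blast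
    show "ssum (T s) = K s" using max(1)[OF TK] p_le p3 by simp
    \<comment> \<open>\<open>K s\<close> is cyclic, so \<open>card_cyc\<close> rules out index
      \<open>p\<close> and leaves order \<open>p\<close>.\<close>
    obtain x where x: "x \<in> K s" "card (K s) \<le> card (cyc x)" using max(2)[OF TK] p_le p3 by auto
    have "(2 * p + 1) * card (K s) \<le> card V"
      using card_cyc[of x] x 1(2) mult_le_mono2[OF x(2), of "2 * p + 1"] by auto
    moreover have "p * card (K s) < (2 * p + 1) * card (K s)" using p_le p3 by simp
    ultimately show cK: "card (K s) = p" using *(4) by linarith
    show "size (T s) + 1 = p" using *(3) cK by simp
    \<comment> \<open>\<open>T s\<close> already has the \<open>card (K s) - 1\<close> terms that
      regularity allows in \<open>K s\<close>.\<close>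
    show "s \<notin> K s"
    proof
      assume "s \<in> K s"
      then have "{#y \<in># S. y \<in> K s#} = add_mset s (T s)"
        using s by (metis T_def filter_mset_add_mset insert_DiffM)
      then have "size {#y \<in># S. y \<in> K s#} = card (K s)" using *(3) by simp
      moreover have "K s \<noteq> V" using cK p_less by auto
      ultimately show False using S 1 by (auto simp: regular_in_def)
    qed
  qed
  have "S \<noteq> {#}" using size index_large p3 by auto
  then obtain s1 where s1: "s1 \<in># S" by blast
  have "T s1 \<noteq> {#}" using K(6)[OF s1] p3 by auto
  then obtain s2 where s2: "s2 \<in># T s1" by blast
  have s2K: "s2 \<in> K s1" and s2S: "s2 \<in># S" using s2 unfolding T_def set_mset_filter by (auto dest: in_diffD)
  \<comment> \<open>By regularity the two groups of order \<open>p\<close> together hold fewer than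
    \<open>2 * p\<close> terms of \<open>S\<close>, and \<open>S\<close> is longer.\<close>
  have "\<exists>s3\<in>#S. s3 \<notin> K s1 \<and> s3 \<notin> K s2"
  proof (rule ccontr)
    assume *: "\<not> ?thesis"
    have small: "size {#y \<in># S. y \<in> K s#} < p" if "s \<in># S" for s
    proof -
      have "K s \<noteq> V" using K(3)[OF that] p_less by auto
      then show ?thesis using S K(1-3)[OF that] by (auto simp: regular_in_def)
    qed
    have "S = {#y \<in># S. y \<in> K s1#} + {#y \<in># S. y \<notin> K s1#}" by (rule multiset_partition)
    then have "size S = size {#y \<in># S. y \<in> K s1#} + size {#y \<in># S. y \<notin> K s1#}" by (metis size_union)
    also have "size {#y \<in># S. y \<notin> K s1#} \<le> size {#y \<in># S. y \<in> K s2#}"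
      using * by (intro size_mset_mono) (auto simp: subseteq_mset_def not_in_iff)
    finally have "size S < 2 * p" using small[OF s1] small[OF s2S] by simp
    then show False using size index_large p3 by linarith
  qed
  then obtain s3 where s3: "s3 \<in># S" "s3 \<notin> K s1" "s3 \<notin> K s2" by blast
  \<comment> \<open>\<open>T s\<close> survives the removal of \<open>s3\<close>, and its sums fill
    the group \<open>K s\<close>, which therefore stabilizes all sums of
    \<open>S - {#s3#}\<close>.\<close>
  have "K s \<subseteq> K s3" if "s \<in># S" "s3 \<notin> K s" for s
  proof -
    have "s3 \<notin># T s" using that(2) unfolding T_def set_mset_filter by blast
    then have "T s \<subseteq># S - {#s3#}"
      using TS[of s] by (simp add: subseteq_mset_def not_in_iff)
    then have "stab (ssum (T s)) \<subseteq> K s3" unfolding K_def[of s3] by (rule stab_ssum_mono)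
    moreover have "K s \<subseteq> stab (ssum (T s))"
      unfolding K(5)[OF that(1)]
      by (rule subset_stab) (use K[OF that(1)] finite_subgrp in \<open>auto simp: subgrp_sumset_self\<close>)
    ultimately show ?thesis by blast
  qed
  then have "K s1 \<subseteq> K s3" "K s2 \<subseteq> K s3" using s1 s2S s3 by auto
  moreover have "finite (K s3)" using K(2)[OF s3(1)] by (rule finite_subgrp)
  ultimately have "K s1 = K s3" "K s2 = K s3" using K(3) s1 s2S s3(1) by (metis card_subset_eq)+
  then show False using s2K K(4)[OF s2S] by simp
qed

theorem additive_basis_in:
  assumes S: "regular_in V S" and size: "card V div p + p - 2 \<le> size S" and x: "x \<in> V"
  shows "\<exists>T. T \<subseteq># S \<and> T \<noteq> {#} \<and> sum_mset T = x"
proof (cases "x = 0")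
  case True
  then show ?thesis using zero_sum[OF S size] by (auto simp: zero_sum_free_def)
next
  case False
  have "card V div p \<le> size S" using size p3 by linarith
  then have "ssum S = V" using periodic_imp_full[OF S size not_aperiodic[OF S]] by blast
  then obtain T where "T \<subseteq># S" "sum_mset T = x" using x by (auto simp: ssum_def)
  then show ?thesis using False by (intro exI[of _ T]) auto
qed

section \<open>The extremal sequence\<close>

text \<open>With at most \<open>p - 2\<close> copies of \<open>e\<close>, every sum lies in a coset
  of \<open>nmul i e\<close> modulo \<open>H\<close> with \<open>i \<le> p - 2\<close>, so the coset
  of \<open>nmul (p - 1) e\<close> is missed.\<close>

theorem extremal_sequence:
  assumes H: "subgrp H" "H \<subseteq> V" "p * card H = card V"
  shows "\<exists>S. regular_in V S \<and> size S = card V div p + p - 3 \<and> \<not> V \<subseteq> ssum S"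
proof -
  have finH: "finite H" using H(2) by (rule finite_subgrp)
  have cH: "0 < card H" using finH subgrp_zero[OF H(1)] by (auto simp: card_gt_0_iff)
  have "H \<noteq> V" using H(3) cH p3 by auto
  then obtain e where e: "e \<in> V" "e \<notin> H" using H(2) by blast
  note ne = nmul_notin[OF H(1) e]
  define S where "S = mset_set (H - {0}) + replicate_mset (p - 2) e"
  have "regular_in V S"
    unfolding regular_in_def
  proof (intro conjI allI impI)
    show "set_mset S \<subseteq> V" using H e finH by (auto simp: S_def)
    fix K assume K: "subgrp K \<and> K \<subseteq> V \<and> K \<noteq> V"
    then have finK: "finite K" by (intro finite_subgrp) blast
    have "{#x \<in># mset_set (H - {0}). x \<in> K#} = mset_set (H \<inter> K - {0})"
      using finH by (subst filter_mset_mset_set) (auto intro: arg_cong[of _ _ mset_set])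
    moreover have "card (H \<inter> K - {0}) + 1 = card (H \<inter> K)"
      using K subgrp_zero[OF H(1)] subgrp_zero[of K] finH card.remove[of "H \<inter> K" 0] by simp
    ultimately have size: "size {#x \<in># S. x \<in> K#} + 1 =
        card (H \<inter> K) + size {#x \<in># replicate_mset (p - 2) e. x \<in> K#}"
      by (simp add: S_def)
    show "size {#x \<in># S. x \<in> K#} < card K"
    proof (cases "e \<in> K")
      case False
      then have empty: "{#x \<in># replicate_mset (p - 2) e. x \<in> K#} = {#}" by (intro multiset_eqI) auto
      have "size {#x \<in># replicate_mset (p - 2) e. x \<in> K#} = 0" by (simp only: empty size_empty)
      moreover have "card (H \<inter> K) \<le> card K" using finK by (intro card_mono) auto
      ultimately show ?thesis using size by linarith
    next
      case True
      have "size {#x \<in># replicate_mset (p - 2) e. x \<in> K#} \<le> p - 2"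
        using size_filter_mset_lesseq[of _ "replicate_mset (p - 2) e"] by simp
      \<comment> \<open>If \<open>K\<close> contains \<open>e\<close>, the multiples of
        \<open>e\<close> give \<open>p\<close> distinct cosets of \<open>H \<inter> K\<close> inside
        \<open>K\<close>, which makes room for the \<open>p - 2\<close> copies of
        \<open>e\<close>.\<close>
      moreover have "p * card (H \<inter> K) \<le> card K"
      proof -
        have "(\<Union>i<p. {nmul i e} + (H \<inter> K)) \<subseteq> K"
        proof (rule UN_least)
          fix i
          show "{nmul i e} + (H \<inter> K) \<subseteq> K"
            using sumset_mono[of "{nmul i e}" K "H \<inter> K" K] nmul_mem[of K e i] K True
            by (auto simp: subgrp_sumset_self)
        qed
        then have "card (\<Union>i<p. {nmul i e} + (H \<inter> K)) \<le> card K" using finK by (rule card_mono[rotated])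
        then show ?thesis using card_cosets[OF H(1) _ _ ne, of "H \<inter> K"] finH by simp
      qed
      moreover have "0 < card (H \<inter> K)"
        using finH K subgrp_zero[OF H(1)] subgrp_zero[of K] by (auto simp: card_gt_0_iff)
      then have "p + card (H \<inter> K) \<le> p * card (H \<inter> K) + 1"
        using p3 by (cases "card (H \<inter> K)") (simp_all add: algebra_simps)
      ultimately show ?thesis using size p3 by linarith
    qed
  qed
  moreover have "size S = card V div p + p - 3"
  proof -
    have "card V div p = card H" using H(3) p3 by (metis nonzero_mult_div_cancel_left not_numeral_le_zero)
    moreover have "card (H - {0}) + 1 = card H" using finH subgrp_zero[OF H(1)] cH by (simp add: card_Diff_singleton)
    ultimately show ?thesis using p3 by (simp add: S_def)
  qed
  moreover have "nmul (p - 1) e \<notin> ssum S"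
  proof
    assume "nmul (p - 1) e \<in> ssum S"
    then obtain h z where hz: "h \<in> ssum (mset_set (H - {0}))" "z \<in> ssum (replicate_mset (p - 2) e)"
      and eq: "nmul (p - 1) e = h + z" unfolding S_def ssum_union by (auto simp: mem_sumset)
    have h: "h \<in> H" using ssum_subset[OF H(1), of "mset_set (H - {0})"] hz(1) finH by auto
    obtain U where U: "U \<subseteq># replicate_mset (p - 2) e" "z = sum_mset U" using hz(2) by (auto simp: ssum_def)
    then obtain i where i: "i \<le> p - 2" "U = replicate_mset i e" by (auto elim: msubseteq_replicate_msetE)
    have "z = nmul i e" unfolding U i by (induction i) simp_all
    moreover have "nmul (p - 1 - i + i) e = nmul (p - 1 - i) e + nmul i e" by (rule nmul_add)
    moreover have "p - 1 - i + i = p - 1" using i p3 by simp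
    ultimately have "nmul (p - 1 - i) e = h" using eq by simp
    moreover have "0 < p - 1 - i" "p - 1 - i < p" using i p3 by linarith+
    ultimately show False using ne[of "p - 1 - i"] h by simp
  qed
  ultimately show ?thesis using nmul_mem[OF V e(1)] by blast
qed

end

section \<open>The circle group\<close>

text \<open>
  The group of the theorem embeds in \<open>circle \<times> circle\<close>, so that sequences and subgroups can be handled
  in a type of class \<open>ab_group_add\<close>.
\<close>

quotient_type circle = real / "\<lambda>x y. x - y \<in> \<int>"
proof (rule equivpI)
  show "symp (\<lambda>x y::real. x - y \<in> \<int>)"
    by (rule sympI) (metis Ints_minus minus_diff_eq)
  show "transp (\<lambda>x y::real. x - y \<in> \<int>)"
  proof (rule transpI)
    fix x y z :: real
    assume "x - y \<in> \<int>" "y - z \<in> \<int>"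
    then have "(x - y) + (y - z) \<in> \<int>" by (rule Ints_add)
    then show "x - z \<in> \<int>" by simp
  qed
qed (simp add: reflp_def)

instantiation circle :: ab_group_add
begin

lift_definition zero_circle :: circle is 0 .

lift_definition plus_circle :: "circle \<Rightarrow> circle \<Rightarrow> circle" is "(+)"
  by (metis Ints_add add_diff_add)

lift_definition uminus_circle :: "circle \<Rightarrow> circle" is uminus
  by (metis Ints_minus minus_diff_minus)

lift_definition minus_circle :: "circle \<Rightarrow> circle \<Rightarrow> circle" is "(-)"
  by (metis Ints_diff diff_diff_add diff_add_eq diff_diff_eq2 add.commute)

instance
  by (standard; transfer) (simp_all add: algebra_simps)

end

lemma abs_circle_eq_0: "abs_circle r = 0 \<longleftrightarrow> r \<in> \<int>"
  by (simp add: zero_circle_def circle.abs_eq_iff)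

lemma nmul_abs_circle: "nmul n (abs_circle r) = abs_circle (real n * r)"
  by (induction n) (simp_all add: zero_circle_def plus_circle.abs_eq algebra_simps)

lemma nmul_Pair: "nmul n (x, y) = (nmul n x, nmul n y)"
  by (induction n) (simp_all add: zero_prod_def)

lemma abs_circle_fraction_eq:
  assumes "n > 0" "a \<in> {0..<int n}" "b \<in> {0..<int n}"
    and "abs_circle (of_int a / real n) = abs_circle (of_int b / real n)"
  shows "a = b"
proof -
  have "of_int a / real n - of_int b / real n \<in> \<int>" using assms(4) by (simp add: circle.abs_eq_iff)
  then obtain k where "of_int a / real n - of_int b / real n = of_int k" by (auto elim: Ints_cases)
  then have "real_of_int (a - b) = real_of_int (k * int n)" using assms(1) by (simp add: field_simps)
  then have k: "a - b = k * int n" by (simp only: of_int_eq_iff)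
  have "\<bar>a - b\<bar> < int n" using assms by auto
  then have "\<bar>k\<bar> * int n < 1 * int n" by (simp add: k abs_mult)
  then have "k = 0" using assms(1) by simp
  then show ?thesis using k by simp
qed

lemma abs_circle_mod:
  assumes "n > 0"
  shows "abs_circle (of_int (a mod int n) / real n) = abs_circle (of_int a / real n)"
proof -
  have "real_of_int a = real_of_int (a div int n) * real n + real_of_int (a mod int n)"
    by (metis div_mult_mod_eq of_int_add of_int_mult of_int_of_nat_eq)
  then have "of_int (a mod int n) / real n - of_int a / real n = - of_int (a div int n)"
    using assms by (simp add: field_simps)
  then show ?thesis by (simp add: circle.abs_eq_iff)
qed

section \<open>Transfer to groups with a carrier\<close>

lemma sum_nmul_count:
  fixes f :: "'a \<Rightarrow> 'b::comm_monoid_add"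
  assumes "finite A" "set_mset S \<subseteq> A"
  shows "(\<Sum>x\<in>A. nmul (count S x) (f x)) = sum_mset (image_mset f S)"
  using assms(2)
proof (induction S)
  case (add y S)
  have "(\<Sum>x\<in>A. nmul (count (add_mset y S) x) (f x)) =
      (\<Sum>x\<in>A. (if x = y then f x else 0) + nmul (count S x) (f x))"
    by (rule sum.cong) auto
  also have "\<dots> = (\<Sum>x\<in>A. if x = y then f x else 0) + (\<Sum>x\<in>A. nmul (count S x) (f x))"
    by (rule sum.distrib)
  also have "(\<Sum>x\<in>A. if x = y then f x else 0) = f y"
    using add.prems by (subst sum.delta[OF assms(1)]) simp
  also have "(\<Sum>x\<in>A. nmul (count S x) (f x)) = sum_mset (image_mset f S)"
    using add.prems by (intro add.IH) simp
  finally show ?case by simp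
qed simp

locale embedded_group = comm_group G for G :: "('a, 'c) monoid_scheme" (structure) +
  fixes f :: "'a \<Rightarrow> 'b::ab_group_add"
  assumes fin: "finite (carrier G)"
    and inj: "inj_on f (carrier G)"
    and hom: "\<And>x y. x \<in> carrier G \<Longrightarrow> y \<in> carrier G \<Longrightarrow> f (x \<otimes> y) = f x + f y"
begin

lemma f_one: "f \<one> = 0"
  using hom[of \<one> \<one>] by simp

lemma f_inv: "x \<in> carrier G \<Longrightarrow> f (inv x) = - f x"
  using hom[of x "inv x"] f_one by (simp add: eq_neg_iff_add_eq_0 add.commute)

lemma f_pow: "x \<in> carrier G \<Longrightarrow> f (x [^] (n::nat)) = nmul n (f x)"
  by (induction n) (simp_all add: f_one hom add.commute)

lemma f_finprod:
  "finite A \<Longrightarrow> h \<in> A \<rightarrow> carrier G \<Longrightarrow> f (finprod G h A) = (\<Sum>x\<in>A. f (h x))"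
proof (induction A rule: finite_induct)
  case (insert a A)
  then have "f (finprod G h (insert a A)) = f (h a \<otimes> finprod G h A)" by (subst finprod_insert) auto
  also have "\<dots> = f (h a) + f (finprod G h A)" using insert.prems by (intro hom finprod_closed) auto
  also have "f (finprod G h A) = (\<Sum>x\<in>A. f (h x))" using insert by auto
  finally show ?case using insert by simp
qed (simp add: f_one)

lemma f_seq_sum:
  assumes "set_mset S \<subseteq> carrier G" shows "f (seq_sum G S) = sum_mset (image_mset f S)"
proof -
  have "f (seq_sum G S) = (\<Sum>x\<in>set_mset S. f (x [^] count S x))"
    unfolding seq_sum_def using assms by (intro f_finprod) auto
  also have "\<dots> = (\<Sum>x\<in>set_mset S. nmul (count S x) (f x))"
    using assms by (intro sum.cong) (auto simp: f_pow)
  also have "\<dots> = sum_mset (image_mset f S)" by (rule sum_nmul_count) auto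
  finally show ?thesis .
qed

lemma seq_sum_closed: "set_mset S \<subseteq> carrier G \<Longrightarrow> seq_sum G S \<in> carrier G"
  unfolding seq_sum_def by (intro finprod_closed) auto

abbreviation V :: "'b set" where
  "V \<equiv> f ` carrier G"

definition f' :: "'b \<Rightarrow> 'a" where
  "f' = the_inv_into (carrier G) f"

lemma f'_f [simp]: "x \<in> carrier G \<Longrightarrow> f' (f x) = x"
  unfolding f'_def by (rule the_inv_into_f_f[OF inj])

lemma f_f' [simp]: "y \<in> V \<Longrightarrow> f (f' y) = y"
  by auto

lemma image_f'_f: "set_mset S \<subseteq> carrier G \<Longrightarrow> image_mset f' (image_mset f S) = S"
  by (induction S) auto

lemma image_f_f': "set_mset S \<subseteq> V \<Longrightarrow> image_mset f (image_mset f' S) = S"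
  by (induction S) auto

lemma subgrp_V: "subgrp V"
  unfolding subgrp_def
proof safe
  show "0 \<in> V" using f_one by (metis image_eqI one_closed)
next
  fix x y assume "x \<in> carrier G" "y \<in> carrier G"
  then have "f x - f y = f (x \<otimes> inv y)" by (simp add: hom f_inv)
  then show "f x - f y \<in> V" using \<open>x \<in> carrier G\<close> \<open>y \<in> carrier G\<close> by blast
qed

lemma card_V: "card V = order G"
  by (simp add: card_image[OF inj] order_def)

lemma subgrp_image: assumes "subgroup H G" shows "subgrp (f ` H)"
  unfolding subgrp_def
proof safe
  interpret H: subgroup H G by (rule assms)
  show "0 \<in> f ` H" using f_one by (metis image_eqI H.one_closed)
  fix x y assume "x \<in> H" "y \<in> H"
  then have "f x - f y = f (x \<otimes> inv y)" by (simp add: hom f_inv)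
  then show "f x - f y \<in> f ` H" using \<open>x \<in> H\<close> \<open>y \<in> H\<close> by (metis H.m_closed H.m_inv_closed image_eqI)
qed

lemma subgroup_vimage:
  assumes "subgrp K" shows "subgroup {x \<in> carrier G. f x \<in> K} G"
proof (rule subgroupI)
  have "\<one> \<in> {x \<in> carrier G. f x \<in> K}" using subgrp_zero[OF assms] by (simp add: f_one)
  then show "{x \<in> carrier G. f x \<in> K} \<noteq> {}" by blast
qed (use assms in \<open>auto simp: f_inv hom intro: subgrp_minus subgrp_plus\<close>)

lemma regular_iff:
  assumes S: "set_mset S \<subseteq> carrier G"
  shows "regular_seq G S \<longleftrightarrow> regular_in V (image_mset f S)"
proof
  assume reg: "regular_seq G S"
  show "regular_in V (image_mset f S)"
    unfolding regular_in_def
  proof (intro conjI allI impI)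
    show "set_mset (image_mset f S) \<subseteq> V" using S by auto
    fix K assume K: "subgrp K \<and> K \<subseteq> V \<and> K \<noteq> V"
    let ?H = "{x \<in> carrier G. f x \<in> K}"
    have fH: "f ` ?H = K" using K by auto
    then have "?H \<noteq> carrier G" using K by auto
    then have "size {#x \<in># S. x \<in> ?H#} \<le> card ?H - 1"
      using reg subgroup_vimage[of K] K unfolding regular_seq_def by blast
    also have "card ?H = card K" using card_image[of f ?H] inj_on_subset[OF inj, of ?H] fH by simp
    also have "{#x \<in># S. x \<in> ?H#} = {#x \<in># S. f x \<in> K#}" using S by (intro filter_mset_cong) auto
    finally have "size {#y \<in># image_mset f S. y \<in> K#} \<le> card K - 1" by (simp add: filter_mset_image_mset)
    moreover have "finite K" using K fin by (auto intro: finite_subset)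
    then have "0 < card K" using K subgrp_zero[of K] by (auto simp: card_gt_0_iff)
    ultimately show "size {#y \<in># image_mset f S. y \<in> K#} < card K" by linarith
  qed
next
  assume reg: "regular_in V (image_mset f S)"
  show "regular_seq G S"
    unfolding regular_seq_def seq_over_def
  proof (intro conjI allI impI)
    show "set_mset S \<subseteq> carrier G" by (rule S)
    fix H assume H: "subgroup H G \<and> H \<noteq> carrier G"
    then have HG: "H \<subseteq> carrier G" using subgroup.subset by blast
    have mem: "f x \<in> f ` H \<longleftrightarrow> x \<in> H" if "x \<in> carrier G" for x
      using inj_on_image_mem_iff[OF inj that HG] .
    have "f ` H \<noteq> V" using H HG inj inj_on_image_eq_iff by blast
    then have "size {#y \<in># image_mset f S. y \<in> f ` H#} < card (f ` H)"
      using reg subgrp_image[of H] H HG unfolding regular_in_def by blast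
    also have "card (f ` H) = card H" using inj_on_subset[OF inj HG] by (rule card_image)
    also have "{#y \<in># image_mset f S. y \<in> f ` H#} = image_mset f {#x \<in># S. f x \<in> f ` H#}"
      by (rule filter_mset_image_mset)
    also have "{#x \<in># S. f x \<in> f ` H#} = {#x \<in># S. x \<in> H#}" using S mem by (intro filter_mset_cong) auto
    finally show "size {#x \<in># S. x \<in> H#} \<le> card H - 1" by simp
  qed
qed

lemma additive_basis_iff:
  assumes S: "set_mset S \<subseteq> carrier G"
  shows "additive_basis G S \<longleftrightarrow>
    (\<forall>x\<in>V. \<exists>T. T \<subseteq># image_mset f S \<and> T \<noteq> {#} \<and> sum_mset T = x)"
proof
  assume basis: "additive_basis G S"
  show "\<forall>x\<in>V. \<exists>T. T \<subseteq># image_mset f S \<and> T \<noteq> {#} \<and> sum_mset T = x"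
  proof
    fix x assume "x \<in> V"
    then obtain g where g: "g \<in> carrier G" "x = f g" by blast
    then have "g \<in> subseq_sums G S" using basis by (simp add: additive_basis_def)
    then obtain T where T: "T \<subseteq># S" "T \<noteq> {#}" "g = seq_sum G T" by (auto simp: subseq_sums_def)
    have "set_mset T \<subseteq> carrier G" using set_mset_mono[OF T(1)] S by (rule subset_trans)
    then have "sum_mset (image_mset f T) = x" unfolding g(2) T(3) by (rule f_seq_sum[symmetric])
    then show "\<exists>T. T \<subseteq># image_mset f S \<and> T \<noteq> {#} \<and> sum_mset T = x"
      using T(2) image_mset_subseteq_mono[OF T(1)] by (intro exI[of _ "image_mset f T"]) simp
  qed
next
  assume full: "\<forall>x\<in>V. \<exists>T. T \<subseteq># image_mset f S \<and> T \<noteq> {#} \<and> sum_mset T = x"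
  have "g \<in> subseq_sums G S" if g: "g \<in> carrier G" for g
  proof -
    obtain T where T: "T \<subseteq># image_mset f S" "T \<noteq> {#}" "sum_mset T = f g" using full g by blast
    let ?T = "image_mset f' T"
    have sub: "?T \<subseteq># S" using image_mset_subseteq_mono[OF T(1), of f'] by (simp add: image_f'_f[OF S])
    have TG: "set_mset ?T \<subseteq> carrier G" using set_mset_mono[OF sub] S by (rule subset_trans)
    have "set_mset T \<subseteq> f ` set_mset S" using set_mset_mono[OF T(1)] by simp
    then have "set_mset T \<subseteq> V" using image_mono[OF S] by (rule subset_trans)
    then have "f (seq_sum G ?T) = f g" using f_seq_sum[OF TG] T(3) by (simp only: image_f_f')
    then have "seq_sum G ?T = g" by (rule inj_onD[OF inj _ seq_sum_closed[OF TG] g])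
    then show ?thesis using sub T(2) unfolding subseq_sums_def by (intro CollectI exI[of _ ?T]) simp
  qed
  moreover have "subseq_sums G S \<subseteq> carrier G"
  proof
    fix g assume "g \<in> subseq_sums G S"
    then obtain T where T: "g = seq_sum G T" "T \<subseteq># S" unfolding subseq_sums_def by blast
    show "g \<in> carrier G"
      unfolding T(1) by (rule seq_sum_closed[OF subset_trans[OF set_mset_mono[OF T(2)] S]])
  qed
  ultimately show "additive_basis G S" unfolding additive_basis_def by blast
qed

end

section \<open>The value of the invariant\<close>

lemma c0_eqI:
  fixes G :: "('a, 'c) monoid_scheme" and f :: "'a \<Rightarrow> 'b::ab_group_add"
  assumes "embedded_group G f" and "small_exponent_group (f ` carrier G) p"
    and H: "subgrp H" "H \<subseteq> f ` carrier G" "p * card H = order G"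
  shows "c0 G = order G div p + p - 2"
proof -
  interpret E: embedded_group G f by (rule assms(1))
  interpret small_exponent_group "f ` carrier G" p by (rule assms(2))
  let ?t = "order G div p + p - 2"
  show ?thesis
    unfolding c0_def
  proof (rule Least_equality)
    show "\<forall>S. regular_seq G S \<and> ?t \<le> size S \<longrightarrow> additive_basis G S"
    proof (intro allI impI)
      fix S assume S: "regular_seq G S \<and> ?t \<le> size S"
      then have SG: "set_mset S \<subseteq> carrier G" by (simp add: regular_seq_def seq_over_def)
      have "regular_in (f ` carrier G) (image_mset f S)" using S E.regular_iff[OF SG] by blast
      moreover have "card (f ` carrier G) div p + p - 2 \<le> size (image_mset f S)"
        using S by (simp add: E.card_V)
      ultimately show "additive_basis G S"
        unfolding E.additive_basis_iff[OF SG] using additive_basis_in by blast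
    qed
  next
    fix t assume t: "\<forall>S. regular_seq G S \<and> t \<le> size S \<longrightarrow> additive_basis G S"
    obtain U where U: "regular_in (f ` carrier G) U" "size U = order G div p + p - 3"
      "\<not> f ` carrier G \<subseteq> ssum U"
      using extremal_sequence[OF H(1,2)] H(3) unfolding E.card_V by blast
    have UV: "set_mset U \<subseteq> f ` carrier G" using U(1) by (simp add: regular_in_def)
    let ?S = "image_mset E.f' U"
    have SG: "set_mset ?S \<subseteq> carrier G" using UV by auto
    have fS: "image_mset f ?S = U" using UV by (rule E.image_f_f')
    have reg: "regular_seq G ?S" unfolding E.regular_iff[OF SG] fS by (rule U(1))
    have not_basis: "\<not> additive_basis G ?S"
    proof
      assume "additive_basis G ?S"
      then have basis: "\<forall>x\<in>f ` carrier G. \<exists>T. T \<subseteq># U \<and> T \<noteq> {#} \<and> sum_mset T = x"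
        unfolding E.additive_basis_iff[OF SG] fS .
      have "f ` carrier G \<subseteq> ssum U"
      proof
        fix x assume "x \<in> f ` carrier G"
        then obtain T where "T \<subseteq># U" "sum_mset T = x" using bspec[OF basis] by blast
        then show "x \<in> ssum U" unfolding ssum_def by blast
      qed
      then show False using U(3) by contradiction
    qed
    have "\<not> t \<le> size ?S"
    proof
      assume "t \<le> size ?S"
      with reg have "additive_basis G ?S" by (intro t[rule_format] conjI)
      with not_basis show False by (rule notE)
    qed
    \<comment> \<open>The extremal sequence has \<open>?t - 1\<close> terms;
      \<open>p \<ge> 3\<close> keeps the truncated subtractions exact.\<close>
    then show "?t \<le> t" using U(2) p3 by simp
  qed
qed

theorem theorem1p1:
  fixes G :: "('a, 'b) monoid_scheme" and n1 n2 p :: nat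
  assumes "comm_group G"
    and "n1 > 0" and "n2 > 0" and "n1 dvd n2"
    and "G \<cong> integer_mod_group n1 \<times>\<times> integer_mod_group n2"
    and "Factorial_Ring.prime p" and "p dvd order G"
    and "\<And>q. Factorial_Ring.prime q \<Longrightarrow> q dvd order G \<Longrightarrow> p \<le> q"
    and "p \<ge> 3" and "n1 \<ge> 2 * p" and "order G \<ge> 72 * p ^ 6"
  shows "c0 G = order G div p + p - 2"
proof -
  let ?Z = "integer_mod_group n1 \<times>\<times> integer_mod_group n2"
  interpret G: comm_group G by (rule assms(1))
  obtain h where h: "h \<in> hom G ?Z" "bij_betw h (carrier G) (carrier ?Z)"
    using assms(5) by (auto simp: is_iso_def iso_def)
  have carZ: "carrier ?Z = {0..<int n1} \<times> {0..<int n2}"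
    using assms(2,3) by (simp add: DirProd_def carrier_integer_mod_group)
  \<comment> \<open>A residue \<open>a\<close> modulo \<open>n\<close> is sent to
    \<open>a / n\<close> modulo 1.\<close>
  define emb where "emb z = (abs_circle (of_int (fst z) / real n1), abs_circle (of_int (snd z) / real n2))"
    for z :: "int \<times> int"
  define f where "f = emb \<circ> h"
  have fin: "finite (carrier G)" using bij_betw_finite[OF h(2)] unfolding carZ by simp
  have order: "order G = n1 * n2" using bij_betw_same_card[OF h(2)] unfolding carZ order_def by simp
  have image: "f ` carrier G = emb ` ({0..<int n1} \<times> {0..<int n2})"
    using h(2) unfolding f_def image_comp[symmetric] bij_betw_def carZ by simp
  have inj_emb: "inj_on emb ({0..<int n1} \<times> {0..<int n2})"
  proof (rule inj_onI)
    fix z w assume "z \<in> {0..<int n1} \<times> {0..<int n2}" "w \<in> {0..<int n1} \<times> {0..<int n2}" "emb z = emb w"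
    then have "fst z = fst w" "snd z = snd w"
      using abs_circle_fraction_eq[OF assms(2), of "fst z" "fst w"]
        abs_circle_fraction_eq[OF assms(3), of "snd z" "snd w"] by (auto simp: emb_def)
    then show "z = w" by (rule prod_eqI)
  qed
  interpret E: embedded_group G f
  proof
    show "finite (carrier G)" by (rule fin)
    show "inj_on f (carrier G)"
      using h(2) inj_emb unfolding f_def bij_betw_def carZ by (intro comp_inj_on) auto
    fix x y assume xy: "x \<in> carrier G" "y \<in> carrier G"
    obtain a b c d where "h x = (a, b)" "h y = (c, d)" by fastforce
    moreover from this have "h (x \<otimes>\<^bsub>G\<^esub> y) = ((a + c) mod int n1, (b + d) mod int n2)"
      using hom_mult[OF h(1) xy] by (simp add: DirProd_def)
    ultimately show "f (x \<otimes>\<^bsub>G\<^esub> y) = f x + f y"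
      using assms(2,3) by (simp add: f_def emb_def abs_circle_mod plus_circle.abs_eq add_divide_distrib)
  qed
  \<comment> \<open>No prime divisor of the order is below 3, so \<open>n1 = 2 * p\<close> is
    excluded and \<open>n1\<close> is at least \<open>2 * p + 1\<close>.\<close>
  have odd: "n1 \<noteq> 2 * p"
  proof
    assume "n1 = 2 * p"
    then have "2 dvd order G" by (simp add: order)
    then show False using assms(8)[of 2] assms(9) two_is_prime_nat by simp
  qed
  have small: "small_exponent_group (f ` carrier G) p"
  proof
    show "subgrp (f ` carrier G)" by (rule E.subgrp_V)
    show "finite (f ` carrier G)" using fin by simp
    fix x assume "x \<in> f ` carrier G"
    then obtain a b where x: "x = emb (a, b)" unfolding image by auto
    \<comment> \<open>Since \<open>n1\<close> divides \<open>n2\<close>, multiplication by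
      \<open>n2\<close> kills both coordinates.\<close>
    obtain k where k: "n2 = n1 * k" using assms(4) by (rule dvdE)
    have "real n2 * (of_int a / real n1) = of_int (int k * a)" using assms(2) by (simp add: k)
    moreover have "real n2 * (of_int b / real n2) = of_int b" using assms(3) by simp
    ultimately have "nmul n2 x = 0"
      by (simp add: x emb_def nmul_Pair nmul_abs_circle abs_circle_eq_0 zero_prod_def)
    then have "card (cyc x) \<le> n2" using assms(3) by (rule card_cyc_le)
    moreover have "2 * p + 1 \<le> n1" using assms(10) odd by simp
    ultimately show "(2 * p + 1) * card (cyc x) \<le> card (f ` carrier G)"
      unfolding E.card_V order by (rule mult_le_mono[rotated])
  qed (use assms in \<open>auto simp: E.card_V\<close>)
  interpret small_exponent_group "f ` carrier G" p by (rule small)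
  have "p dvd n2" using assms(4,6,7) by (auto simp: order prime_dvd_mult_iff intro: dvd_trans)
  then obtain m where m: "n2 = p * m" by (rule dvdE)
  \<comment> \<open>\<open>H\<close> is the set of pairs whose second residue is divisible by
    \<open>p\<close>, a subgroup of index \<open>p\<close>; the multiples of the generator
    \<open>e\<close> of the second factor represent its cosets.\<close>
  define H where "H = {x \<in> f ` carrier G. nmul m (snd x) = 0}"
  define e where "e = emb (0, 1)"
  have m_frac: "real m * (r / real n2) = r / real p" for r
    using assms(3) by (auto simp: m)
  have H: "subgrp H"
  proof -
    have "nmul m (- x) = - nmul m x" for x :: circle
      using nmul_plus[of m x "- x"] by (simp add: eq_neg_iff_add_eq_0 add.commute)
    then have "nmul m (x - y) = nmul m x - nmul m y" for x y :: circle
      using nmul_plus[of m x "- y"] by simp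
    then have diff: "nmul m (snd (x - y)) = nmul m (snd x) - nmul m (snd y)" for x y :: "circle \<times> circle"
      by simp
    have "x - y \<in> H" if "x \<in> H" "y \<in> H" for x y
      using that subgrp_diff[OF E.subgrp_V, of x y] diff[of x y] unfolding H_def by simp
    moreover have "0 \<in> H" using subgrp_zero[OF E.subgrp_V] unfolding H_def by simp
    ultimately show ?thesis by (simp add: subgrp_def)
  qed
  have HV: "H \<subseteq> f ` carrier G" by (auto simp: H_def)
  have "p * 1 \<le> n2" using assms(3) m by (intro dvd_imp_le) auto
  then have eV: "e \<in> f ` carrier G" unfolding image e_def using assms(2,9) by (intro imageI) auto
  have "e \<notin> H"
  proof
    assume "e \<in> H"
    then have "nmul m (abs_circle (1 / real n2)) = 0" by (simp add: H_def e_def emb_def)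
    then have "1 / real p \<in> \<int>" by (simp only: nmul_abs_circle m_frac abs_circle_eq_0)
    then obtain k where "1 / real p = of_int k" by (rule Ints_cases)
    then have "real_of_int 1 = real_of_int (k * int p)" using assms(9) by (simp add: field_simps)
    then have "1 = k * int p" by (simp only: of_int_eq_iff)
    then have "int p dvd 1" by (rule dvdI[OF trans[OF _ mult.commute]])
    then show False using assms(9) by simp
  qed
  then have "H \<noteq> f ` carrier G" using eV by blast
  then have le: "p * card H \<le> card (f ` carrier G)" using H HV by (intro card_proper)
  \<comment> \<open>Splitting off \<open>b mod p\<close> from the second residue leaves a multiple
    of \<open>p\<close>, so \<open>p\<close> cosets of \<open>H\<close> cover the group; this gives
    the inequality opposite to \<open>le\<close>.\<close>
  have "f ` carrier G \<subseteq> (\<Union>i<p. {nmul i e} + H)"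
  proof
    fix x assume "x \<in> f ` carrier G"
    then obtain a b where ab: "a \<in> {0..<int n1}" "b \<in> {0..<int n2}" "x = emb (a, b)" unfolding image by auto
    define i where "i = nat (b mod int p)"
    have i: "int i = b mod int p" "i < p" using assms(9) by (simp_all add: i_def nat_less_iff)
    define c where "c = b - int i"
    have c: "c = int p * (b div int p)" unfolding c_def i by (simp add: minus_mod_eq_mult_div)
    have "0 \<le> c" using ab(2) assms(9) by (simp add: c pos_imp_zdiv_nonneg_iff)
    then have "c \<in> {0..<int n2}" using ab(2) by (simp add: c_def)
    then have "emb (a, c) \<in> f ` carrier G" unfolding image using ab(1) by auto
    moreover have "of_int c / real p = of_int (b div int p)" using assms(9) by (simp add: c)
    then have "nmul m (snd (emb (a, c))) = 0"
      by (simp only: emb_def snd_conv nmul_abs_circle m_frac abs_circle_eq_0 Ints_of_int)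
    ultimately have "emb (a, c) \<in> H" by (simp add: H_def)
    moreover have "x = nmul i e + emb (a, c)"
      by (simp add: ab(3) e_def emb_def nmul_Pair nmul_abs_circle plus_circle.abs_eq c_def diff_divide_distrib)
    ultimately have "x \<in> {nmul i e} + H" by (auto simp: mem_sumset)
    then show "x \<in> (\<Union>i<p. {nmul i e} + H)" using i(2) by blast
  qed
  moreover have "finite H" using HV by (rule finite_subgrp)
  ultimately have "card (f ` carrier G) \<le> card (\<Union>i<p. {nmul i e} + H)" by (intro card_mono) auto
  also have "\<dots> \<le> (\<Sum>i<p. card ({nmul i e} + H))" by (rule card_UN_le) simp
  also have "\<dots> = p * card H" by simp
  finally have "p * card H = order G" using le by (simp add: E.card_V)
  then show ?thesis using E.embedded_group_axioms small H HV by (intro c0_eqI)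
qed

end
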